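(* Let $d,q,s$ be positive integers and let $M\ge\max\{2q+1,\,9\cdot4^d\cdot d^2\cdot s^2\}$ be a prime number. Let $m=\lfloor M/2\rfloor+1$ and $\mathbf x_j=\cos(\mathbf p_j)$ (componentwise), $\mathbf p_j=2\pi(j,j^2,\ldots,j^d)/M$, $j=0,\ldots,m-1$. Let $f=\sum_{\mathbf n\in\Lambda_{\mathbf P}^{q,d}}c_{\mathbf n}\mathbf\Phi_{\mathbf n}$ with $\mathbf c=(c_{\mathbf n})\in\mathbb{C}^{(q+1)^d}$. Let $\mathbf A=\mathbf A_{\mathbf P}\mathbf C$, where $\mathbf A_{\mathbf P}=[\mathbf\Phi_{\mathbf n}(\mathbf x_j)]_{j=0,\ldots,m-1;\ \mathbf n\in\Lambda_{\mathbf P}^{q,d}}$ and $\mathbf C$ is the diagonal matrix for which every column of $\mathbf A$ has unit $\ell_2$ norm, let $\mathbf b=(f(\mathbf x_0),\ldots,f(\mathbf x_{m-1}))^\top$, and let $\mathbf c^\#$ be a solution of $\min\{\|\mathbf z\|_1:\mathbf z\in\mathbb{C}^{(q+1)^d},\ \mathbf A\mathbf z=\mathbf b\}$. Then, with $\tilde{\mathbf c}=\mathbf C^{-1}\mathbf c$, there is a constant $K>0$ not depending on $\mathbf c$ such that $$\|\mathbf c^\#-\tilde{\mathbf c}\|_2\le K\,\frac{\sigma_{s,1}(\tilde{\mathbf c})}{\sqrt s}.$$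
   Context: $\mathbb N=\{0,1,2,\ldots\}$, $\Lambda_{\mathbf P}^{q,d}=\{\mathbf n\in\mathbb N^d:\max_j n_j\le q\}$, and $\mathbf\Phi_{\mathbf n}(\mathbf x)=\prod_{t=1}^d\cos(n_t\arccos x_t)$ for $\mathbf x\in[-1,1]^d$. For $\mathbf v\in\mathbb{C}^N$, $\sigma_{s,1}(\mathbf v)=\min\{\|\mathbf v-\mathbf z\|_1:\mathbf z\in\mathbb{C}^N,\ \mathbf z\text{ has at most }s\text{ nonzero entries}\}$. *)

theory Defs
  imports "HOL-Analysis.Analysis"
begin

text \<open>Multi-indices n in N^d are represented as functions nat => nat that vanish at
  coordinates t >= d. Lambda_P^{q,d} = {n : max_t n_t <= q}.\<close>
definition LambdaP :: "nat \<Rightarrow> nat \<Rightarrow> (nat \<Rightarrow> nat) set" where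
  "LambdaP q d = {n. (\<forall>t<d. n t \<le> q) \<and> (\<forall>t\<ge>d. n t = 0)}"

definition Phi :: "nat \<Rightarrow> (nat \<Rightarrow> nat) \<Rightarrow> (nat \<Rightarrow> real) \<Rightarrow> real" where
  "Phi d n x = (\<Prod>t<d. cos (real (n t) * arccos (x t)))"

definition samplept :: "nat \<Rightarrow> nat \<Rightarrow> nat \<Rightarrow> nat \<Rightarrow> real" where
  "samplept M d j t = (if t < d then cos (2 * pi * real (j ^ (t + 1)) / real M) else 0)"

definition AP :: "nat \<Rightarrow> nat \<Rightarrow> nat \<Rightarrow> (nat \<Rightarrow> nat) \<Rightarrow> real" where
  "AP M d j n = Phi d n (samplept M d j)"

definition nsamples :: "nat \<Rightarrow> nat" where
  "nsamples M = M div 2 + 1"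

text \<open>Diagonal entry C_n of the normalizing matrix C: every column of A = A_P C has unit
  l2 norm, i.e. C_n = 1 / ||column n of A_P||_2.\<close>
definition Cdiag :: "nat \<Rightarrow> nat \<Rightarrow> (nat \<Rightarrow> nat) \<Rightarrow> real" where
  "Cdiag M d n = 1 / sqrt (\<Sum>j<nsamples M. (AP M d j n)\<^sup>2)"

definition Amat :: "nat \<Rightarrow> nat \<Rightarrow> nat \<Rightarrow> (nat \<Rightarrow> nat) \<Rightarrow> complex" where
  "Amat M d j n = complex_of_real (AP M d j n * Cdiag M d n)"

text \<open>Vectors in C^{(q+1)^d} are functions on LambdaP q d (values outside are ignored).\<close>
definition norm1 :: "('i \<Rightarrow> complex) \<Rightarrow> 'i set \<Rightarrow> real" where
  "norm1 v I = (\<Sum>i\<in>I. cmod (v i))"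

definition norm2 :: "('i \<Rightarrow> complex) \<Rightarrow> 'i set \<Rightarrow> real" where
  "norm2 v I = sqrt (\<Sum>i\<in>I. (cmod (v i))\<^sup>2)"

definition sigma_s1 :: "nat \<Rightarrow> ('i \<Rightarrow> complex) \<Rightarrow> 'i set \<Rightarrow> real" where
  "sigma_s1 s v I = Inf {norm1 (\<lambda>i. v i - z i) I | z. card {i\<in>I. z i \<noteq> 0} \<le> s}"

end

theory Submission
  imports "HOL-Algebra.Algebraic_Closure_Type" "Berlekamp_Zassenhaus.Finite_Field" Defs
begin

text \<open>
  Writing the cosines as exponentials, the inner products of columns of the sampling matrix become
  averages of complete exponential sums of integer polynomials of degree at most \<open>d\<close> modulo \<open>M\<close>,
  halved by the symmetry \<open>j \<mapsto> M - j\<close>. Weil's bound \<open>(d - 1) \<surd>M\<close> for these sums gives normalized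
  columns of coherence \<open>\<mu>\<close> with \<open>(2s - 1) \<mu> < 1\<close>. A kernel vector \<open>v\<close> then satisfies
  \<open>|v_n| \<le> \<mu> / (1 + \<mu>) \<parallel>v\<parallel>\<^sub>1\<close> for every \<open>n\<close>, which is a null space property of order \<open>s\<close>.

  Weil's bound is obtained by Stepanov's method in the form given by Bombieri. The sums over the extensions of the
  prime field are the power sums, up to sign, of the \<open>d - 1\<close> reciprocal roots of an L-polynomial
  \<open>\<Sum>\<^sub>m c\<^sub>m T^m\<close>, where \<open>c\<^sub>m\<close> sums a multiplicative weight over the monic polynomials of degree \<open>m\<close>
  over the prime field. These polynomials are represented by their multisets of roots, that is, by the multisets
  invariant under Frobenius. An auxiliary polynomial bounds the sums over extensions of even degree \<open>2k\<close>
  by \<open>O(p^k)\<close>, which forces all reciprocal roots to have modulus at most \<open>\<surd>p\<close>.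
\<close>

section \<open>Algebraically closed fields of prime characteristic\<close>

lemma proots_prod_mset_linear:
  "proots (\<Prod>x\<in>#A. [:-x, 1:]) = (A :: 'k::field multiset)"
proof (induction A)
  case (add a A)
  have "(\<Prod>x\<in>#A. [:-x, 1:]) \<noteq> 0" by auto
  with add show ?case
    by (simp add: proots_mult del: mult_pCons_left)
qed simp

lemma degree_prod_mset_linear: "degree (\<Prod>x\<in>#A. [:-x, 1::'k::field:]) = size A"
  and lead_coeff_prod_mset_linear: "lead_coeff (\<Prod>x\<in>#A. [:-x, 1::'k:]) = 1"
proof -
  have *: "(\<Prod>x\<in>#A. [:-x, 1::'k:]) \<noteq> 0" for A by auto
  show "degree (\<Prod>x\<in>#A. [:-x, 1::'k:]) = size A"
  proof (induction A)
    case (add x A)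
    have "degree ([:-x, 1:] * (\<Prod>x\<in>#A. [:-x, 1::'k:])) = 1 + size A"
      by (subst degree_mult_eq) (use * add in auto)
    thus ?case by simp
  qed simp
  show "lead_coeff (\<Prod>x\<in>#A. [:-x, 1::'k:]) = 1"
    by (induction A) (auto simp: lead_coeff_mult simp del: mult_pCons_left)
qed

lemma alg_closed_poly_eq_prod_proots:
  fixes P :: "'k::alg_closed_field poly"
  assumes "P \<noteq> 0"
  shows "P = smult (lead_coeff P) (\<Prod>x\<in>#proots P. [:-x, 1:])"
    and "size (proots P) = degree P"
proof -
  obtain A where A: "size A = degree P" "P = smult (lead_coeff P) (\<Prod>x\<in>#A. [:-x, 1:])"
    using alg_closed_imp_factorization[OF assms] by blast
  have "proots P = A"
    using A(2) assms proots_prod_mset_linear by (metis leading_coeff_0_iff proots_smult)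
  with A show "P = smult (lead_coeff P) (\<Prod>x\<in>#proots P. [:-x, 1:])"
    and "size (proots P) = degree P" by simp_all
qed

text \<open>One algebraically closed field carries all finite extensions of the prime field at once,
  as fixed sets of powers of Frobenius. The parameter \<open>K\<close> pins down the type.\<close>

locale prime_char =
  fixes p :: nat and K :: "'k::{alg_closed_field,field_prime_char} itself"
  assumes p_eq: "p = CHAR('k)"
begin

lemma prime_p: "prime p"
  by (simp add: p_eq)

lemma p_gt_0: "p > 0" and p_gt_1: "p > 1"
  using prime_p prime_gt_1_nat by (auto simp: prime_gt_0_nat)

lemma frobenius_add: "(x + y :: 'k) ^ (p ^ n) = x ^ (p ^ n) + y ^ (p ^ n)"
  using freshmans_dream'[of "p ^ n" n x y] prime_p by (simp add: p_eq)

lemma frobenius_sum: "(\<Sum>i\<in>I. g i :: 'k) ^ (p ^ n) = (\<Sum>i\<in>I. g i ^ (p ^ n))"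
  using freshmans_dream_sum'[of "p ^ n" n g I] prime_p by (simp add: p_eq)

lemma frobenius_diff: "(x - y :: 'k) ^ (p ^ n) = x ^ (p ^ n) - y ^ (p ^ n)"
  using frobenius_add[of "x - y" y n] by (simp add: algebra_simps)

lemma frobenius_inj: "x ^ (p ^ n) = y ^ (p ^ n) \<longleftrightarrow> x = (y :: 'k)"
  using frobenius_diff[of x y n] p_gt_0 by auto

lemma frobenius_surj: "\<exists>y. y ^ (p ^ n) = (x :: 'k)"
  using nth_root_exists[of "p ^ n" x] p_gt_0 by auto

text \<open>For \<open>r > 0\<close> this is the subfield with \<open>p ^ r\<close> elements, but
  \<open>Fq 0\<close> is the whole field.\<close>

definition Fq :: "nat \<Rightarrow> 'k set" where "Fq r = {x. x ^ (p ^ r) = x}"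

text \<open>With \<open>q = p ^ r\<close>, the polynomial \<open>X^q - X\<close> has derivative
  \<open>-1\<close>, so none of its \<open>q\<close> roots is multiple.\<close>

lemma card_Fq:
  assumes "r > 0"
  shows "finite (Fq r)" "card (Fq r) = p ^ r"
proof -
  define q where "q = p ^ r"
  have q: "q > 1" unfolding q_def by (rule one_less_power[OF p_gt_1 assms])
  define P :: "'k poly" where "P = monom 1 q - [:0, 1:]"
  have deg: "degree P = q"
  proof -
    have "degree (monom 1 q - [:0, 1 :: 'k:]) = degree (monom (1::'k) q)"
      by (subst diff_conv_add_uminus, rule degree_add_eq_left) (use q in \<open>simp add: degree_monom_eq\<close>)
    thus ?thesis by (simp add: P_def degree_monom_eq)
  qed
  hence P0: "P \<noteq> 0" using q by auto
  have "of_nat q = (0 :: 'k)"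
    using assms by (auto simp: q_def p_eq)
  hence pd: "pderiv P = [:-1:]"
    by (simp add: P_def pderiv_diff pderiv_monom pderiv_pCons)
  have "count (proots P) a \<le> 1" for a
  proof (rule ccontr)
    assume "\<not> count (proots P) a \<le> 1"
    hence "[:-a, 1:] ^ 2 dvd P"
      using P0 by (simp add: order_divides)
    then obtain R where R: "P = [:-a, 1:] * ([:-a, 1:] * R)"
      by (metis dvdE mult.assoc power2_eq_square)
    have "poly (pderiv P) a = 0"
      unfolding R by (subst pderiv_mult) (simp del: mult_pCons_left)
    thus False by (simp add: pd)
  qed
  hence cnt: "count (proots P) a \<le> 1" for a .
  have "count (proots P) a = count (mset_set (set_mset (proots P))) a" for a
  proof (cases "a \<in># proots P")
    case True
    hence "count (proots P) a \<ge> 1" by (metis count_greater_eq_one_iff)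
    with cnt[of a] True show ?thesis by (simp only: count_mset_set(1)[OF finite_set_mset True])
  next
    case False
    hence "count (proots P) a = 0" by (rule not_in_iff[THEN iffD1])
    thus ?thesis using False by (simp only: count_mset_set(3)[OF False])
  qed
  hence "proots P = mset_set (set_mset (proots P))" by (rule multiset_eqI)
  hence "size (proots P) = card (set_mset (proots P))"
    by (metis size_mset_set)
  moreover have "set_mset (proots P) = Fq r"
    using P0 by (auto simp: Fq_def P_def poly_monom q_def)
  ultimately have "size (proots P) = card (Fq r)" "finite (Fq r)"
    using finite_set_mset[of "proots P"] by simp_all
  thus "card (Fq r) = p ^ r" "finite (Fq r)"
    using alg_closed_poly_eq_prod_proots(2)[OF P0] deg by (simp_all add: q_def)
qed

section \<open>The prime field, its additive character and the trace\<close>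

lemma of_int_eq_iff_mod: "of_int a = (of_int b :: 'k) \<longleftrightarrow> a mod int p = b mod int p"
proof -
  have "of_int a = (of_int b :: 'k) \<longleftrightarrow> of_int (a - b) = (0 :: 'k)" by simp
  also have "\<dots> \<longleftrightarrow> int p dvd a - b"
    by (simp only: of_int_eq_0_iff_char_dvd p_eq)
  also have "\<dots> \<longleftrightarrow> a mod int p = b mod int p"
    by (rule mod_eq_dvd_iff[symmetric])
  finally show ?thesis .
qed

lemma of_int_in_Fq: "of_int a \<in> Fq 1"
proof -
  have "of_nat n ^ p = (of_nat n :: 'k)" for n
    by (induction n) (use frobenius_add[of 1 _ 1] p_gt_0 in auto)
  from this[of "nat (a mod int p)"] have "of_int (a mod int p) ^ p = (of_int (a mod int p) :: 'k)"
    using p_gt_0 by simp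
  moreover have "of_int (a mod int p) = (of_int a :: 'k)"
    by (simp add: of_int_eq_iff_mod)
  ultimately show ?thesis by (simp add: Fq_def)
qed

lemma bij_Fq1: "bij_betw (\<lambda>j. of_nat j :: 'k) {..<p} (Fq 1)"
proof -
  have inj: "inj_on (\<lambda>j. of_nat j :: 'k) {..<p}"
  proof (rule inj_onI)
    fix x y assume "x \<in> {..<p}" "y \<in> {..<p}" "of_nat x = (of_nat y :: 'k)"
    thus "x = y" using of_int_eq_iff_mod[of "int x" "int y"] by simp
  qed
  moreover have "(\<lambda>j. of_nat j :: 'k) ` {..<p} \<subseteq> Fq 1"
  proof
    fix x assume "x \<in> (\<lambda>j. of_nat j :: 'k) ` {..<p}"
    then obtain j where "x = of_int (int j)" by auto
    thus "x \<in> Fq 1" using of_int_in_Fq by blast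
  qed
  moreover have "card ((\<lambda>j. of_nat j :: 'k) ` {..<p}) = card (Fq 1)"
    using card_Fq(2)[of 1] card_image[OF inj] by simp
  ultimately show ?thesis
    unfolding bij_betw_def using card_subset_eq[OF card_Fq(1)[OF zero_less_one]] by blast
qed

lemma Fq1_of_int: "x \<in> Fq 1 \<Longrightarrow> \<exists>a. x = of_int a"
proof -
  assume "x \<in> Fq 1"
  then obtain j where "x = of_nat j" using bij_betw_imp_surj_on[OF bij_Fq1] by blast
  thus ?thesis by (intro exI[of _ "int j"]) simp
qed

text \<open>The standard additive character of the prime field. The chosen representative does not
  matter, by \<open>cis_mod_eq\<close>; outside the prime field the value is unspecified but still
  of modulus 1.\<close>

definition psi :: "'k \<Rightarrow> complex" where
  "psi x = cis (2 * pi * real_of_int (SOME a. x = of_int a) / real p)"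

lemma cis_mod_eq:
  assumes "a mod int p = b mod int p"
  shows "cis (2 * pi * of_int a / real p) = cis (2 * pi * of_int b / real p)"
proof -
  from assms obtain k where "a = b + int p * k"
    by (metis mod_eqE mult.commute)
  hence "2 * pi * of_int a / real p = 2 * pi * of_int b / real p + 2 * pi * of_int k"
    using p_gt_0 by (simp add: field_simps)
  thus ?thesis by (simp add: cis_multiple_2pi flip: cis_mult)
qed

lemma psi_of_int: "psi (of_int a) = cis (2 * pi * real_of_int a / real p)"
proof -
  have "of_int a = (of_int (SOME b. of_int a = (of_int b :: 'k)) :: 'k)"
    by (rule someI[of _ a]) simp
  thus ?thesis unfolding psi_def using cis_mod_eq of_int_eq_iff_mod by metis
qed

lemma psi_0 [simp]: "psi 0 = 1"
  using psi_of_int[of 0] by simp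

lemma psi_add: "x \<in> Fq 1 \<Longrightarrow> y \<in> Fq 1 \<Longrightarrow> psi (x + y) = psi x * psi y"
proof -
  assume "x \<in> Fq 1" "y \<in> Fq 1"
  then obtain a b where "x = of_int a" "y = of_int b" using Fq1_of_int by meson
  thus ?thesis using psi_of_int[of "a + b"]
    by (simp add: psi_of_int cis_mult ring_distribs add_divide_distrib)
qed

lemma norm_psi [simp]: "norm (psi x) = 1"
  by (simp add: psi_def)

lemma psi_1_neq: "psi 1 \<noteq> 1"
proof
  assume "psi 1 = 1"
  hence "cis (2 * pi / real p) = 1" using psi_of_int[of 1] by simp
  hence "cos (2 * pi / real p) = 1" by (metis cis.sel(1) one_complex.sel(1))
  then obtain n :: int where "2 * pi / real p = of_int n * 2 * pi"
    using cos_one_2pi_int by auto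
  hence "real_of_int (n * int p) = 1" using p_gt_0 by (simp add: field_simps)
  hence "n * int p = 1" by linarith
  hence "int p dvd 1" by (metis dvd_triv_right)
  thus False using p_gt_1 by simp
qed

lemma Fq_0 [simp]: "0 \<in> Fq r" and Fq_1 [simp]: "1 \<in> Fq r"
  using p_gt_0 by (auto simp: Fq_def)

lemma Fq_add: "x \<in> Fq r \<Longrightarrow> y \<in> Fq r \<Longrightarrow> x + y \<in> Fq r"
  and Fq_diff: "x \<in> Fq r \<Longrightarrow> y \<in> Fq r \<Longrightarrow> x - y \<in> Fq r"
  and Fq_mult: "x \<in> Fq r \<Longrightarrow> y \<in> Fq r \<Longrightarrow> x * y \<in> Fq r"
  and Fq_divide: "x \<in> Fq r \<Longrightarrow> y \<in> Fq r \<Longrightarrow> x / y \<in> Fq r"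
  by (auto simp: Fq_def frobenius_add frobenius_diff power_mult_distrib power_divide)

lemma Fq_uminus: "x \<in> Fq r \<Longrightarrow> - x \<in> Fq r"
  using Fq_diff[of 0 r x] by simp

lemma sum_psi: "(\<Sum>x\<in>Fq 1. psi x) = 0"
proof -
  have "(\<Sum>x\<in>Fq 1. psi x) = (\<Sum>x\<in>Fq 1. psi (x + 1))"
    by (rule sum.reindex_bij_witness[of _ "\<lambda>x. x + 1" "\<lambda>x. x - 1"]) (simp_all add: Fq_add Fq_diff del: One_nat_def)
  also have "\<dots> = psi 1 * (\<Sum>x\<in>Fq 1. psi x)"
    unfolding sum_distrib_left by (intro sum.cong refl) (simp add: psi_add mult.commute del: One_nat_def)
  finally show ?thesis using psi_1_neq by simp
qed

definition trace :: "nat \<Rightarrow> 'k \<Rightarrow> 'k" where "trace r y = (\<Sum>i<r. y ^ (p ^ i))"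

lemma power_p_Suc: "((x::'k) ^ (p ^ i)) ^ p = x ^ (p ^ Suc i)"
  by (simp only: power_mult[symmetric] power_Suc mult.commute)

text \<open>Frobenius permutes the summands of the trace cyclically, the last one returning to
  \<open>y\<close>.\<close>

lemma trace_in_Fq1:
  assumes "y \<in> Fq r"
  shows "trace r y \<in> Fq 1"
proof (cases r)
  case (Suc n)
  have "trace r y ^ p = (\<Sum>i<r. y ^ (p ^ Suc i))"
    using frobenius_sum[of "\<lambda>i. y ^ (p ^ i)" "{..<r}" 1]
    by (simp only: trace_def power_p_Suc power_one_right)
  also have "\<dots> = (\<Sum>i<n. y ^ (p ^ Suc i)) + y ^ (p ^ r)"
    by (simp only: Suc sum.lessThan_Suc)
  also have "\<dots> = (\<Sum>i<n. y ^ (p ^ Suc i)) + y"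
    using assms by (simp only: Fq_def mem_Collect_eq)
  also have "\<dots> = trace r y"
    unfolding trace_def Suc by (subst sum.lessThan_Suc_shift) (simp add: add.commute)
  finally show ?thesis by (simp add: Fq_def)
qed (simp add: trace_def)

end

section \<open>Frobenius-invariant multisets\<close>

context prime_char
begin

text \<open>If \<open>x\<close> has degree \<open>e\<close> dividing \<open>r\<close>, each
  conjugate occurs \<open>r / e\<close> times, as among the roots of the characteristic polynomial
  of \<open>x\<close> on \<open>Fq r\<close>.\<close>

definition orb :: "nat \<Rightarrow> 'k \<Rightarrow> 'k multiset" where
  "orb r x = image_mset (\<lambda>i. x ^ (p ^ i)) (mset_set {..<r})"

text \<open>Root multisets of the monic polynomials of degree \<open>m\<close> over the prime field,
  see \<open>frob_msets_iff\<close>.\<close>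

definition frob_msets :: "nat \<Rightarrow> 'k multiset set" where
  "frob_msets m = {A. size A = m \<and> image_mset (\<lambda>x. x ^ p) A = A}"

lemma size_orb [simp]: "size (orb r x) = r"
  by (simp add: orb_def)

lemma orb_0 [simp]: "orb 0 x = {#}"
  by (simp add: orb_def)

lemma orb_Suc: "orb (Suc r) x = add_mset (x ^ (p ^ r)) (orb r x)"
  by (simp add: orb_def lessThan_Suc)

lemma power_p_power: "((x::'k) ^ (p ^ i)) ^ (p ^ j) = x ^ (p ^ (i + j))"
  by (simp add: power_mult[symmetric] power_add)

lemma orb_add: "orb (r + s) x = orb r x + orb s (x ^ (p ^ r))"
  by (induction s) (simp_all add: orb_Suc power_p_power)

lemma orb_Suc': "orb (Suc r) x = add_mset x (orb r (x ^ p))"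
  using orb_add[of 1 r x] by (simp add: orb_Suc)

lemma orb_in_frob_msets:
  assumes "x \<in> Fq r"
  shows "orb r x \<in> frob_msets r"
proof -
  have "image_mset (\<lambda>x. x ^ p) (orb r x) = orb r (x ^ p)"
    by (simp add: orb_def image_mset.compositionality o_def power_mult[symmetric] mult.commute)
  moreover have "add_mset x (orb r (x ^ p)) = add_mset x (orb r x)"
    using assms by (simp add: orb_Suc Fq_def flip: orb_Suc')
  ultimately show ?thesis by (simp add: frob_msets_def)
qed

lemma frob_msets_add: "A \<in> frob_msets m \<Longrightarrow> B \<in> frob_msets n \<Longrightarrow> A + B \<in> frob_msets (m + n)"
  by (simp add: frob_msets_def)

lemma frob_msets_diff: "A \<in> frob_msets m \<Longrightarrow> B \<in> frob_msets n \<Longrightarrow> B \<subseteq># A \<Longrightarrow> A - B \<in> frob_msets (m - n)"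
  by (auto simp: frob_msets_def size_Diff_submset image_mset_Diff)

lemma count_frobenius:
  assumes "A \<in> frob_msets m"
  shows "count A (x ^ (p ^ i)) = count A x"
proof (induction i)
  case (Suc i)
  have "inj (\<lambda>x::'k. x ^ p)"
    using frobenius_inj[of _ 1] by (auto intro!: injI)
  hence "count (image_mset (\<lambda>x. x ^ p) A) (y ^ p) = count A y" for y
    by (induction A) (auto dest: injD)
  note this[of "x ^ (p ^ i)"]
  with assms Suc show ?case
    by (simp only: frob_msets_def power_p_Suc mem_Collect_eq)
qed simp

lemma orb_mult:
  assumes "x ^ (p ^ e) = x"
  shows "x ^ (p ^ (i * e)) = x" "orb (i * e) x = repeat_mset i (orb e x)"
proof -
  show *: "x ^ (p ^ (i * e)) = x" for i
  proof (induction i)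
    case (Suc i)
    thus ?case using assms power_p_power[of x e "i * e"] by simp
  qed simp
  show "orb (i * e) x = repeat_mset i (orb e x)"
    by (induction i) (simp_all add: orb_add assms)
qed

text \<open>If \<open>x\<close> has degree \<open>e\<close>, the \<open>r\<close> with
  \<open>x\<close> in \<open>Fq r\<close> are the multiples of \<open>e\<close>, and
  \<open>orb (i * e) x\<close> consists of \<open>i\<close> copies of the \<open>e\<close> distinct
  conjugates. As \<open>A\<close> contains all conjugates equally often, it contains these copies
  iff \<open>i\<close> is at most \<open>count A x\<close>.\<close>

lemma card_orb_subset:
  assumes A: "A \<in> frob_msets m"
  shows "card {r \<in> {1..m}. x \<in> Fq r \<and> orb r x \<subseteq># A} = count A x"
proof (cases "x \<in># A")
  case False
  have "\<not> orb r x \<subseteq># A" if "r \<ge> 1" for r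
  proof
    assume "orb r x \<subseteq># A"
    moreover have "x \<in># orb r x"
      using that by (cases r) (auto simp: orb_Suc')
    ultimately show False using False by (meson mset_subset_eqD)
  qed
  hence "{r \<in> {1..m}. x \<in> Fq r \<and> orb r x \<subseteq># A} = {}" by auto
  thus ?thesis using False by (simp add: not_in_iff)
next
  case True
  define o' where "o' = count A x"
  \<comment> \<open>The orbit stays among the finitely many members of \<open>A\<close>, so two of
    its powers agree; injectivity of Frobenius then makes it purely periodic.\<close>
  have "x ^ (p ^ i) \<in># A" for i
    using count_frobenius[OF A, of x i] True by (simp flip: count_greater_zero_iff)
  hence "range (\<lambda>i. x ^ (p ^ i)) \<subseteq> set_mset A" by auto
  hence "finite (range (\<lambda>i. x ^ (p ^ i)))" using finite_subset by blast
  hence "\<not> inj (\<lambda>i. x ^ (p ^ i))" using finite_imageD infinite_UNIV_nat by blast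
  then obtain i j where ij: "i < j" "x ^ (p ^ i) = x ^ (p ^ j)"
    using linorder_injI[of "\<lambda>i. x ^ (p ^ i)"] by blast
  hence "(x ^ (p ^ (j - i))) ^ (p ^ i) = x ^ (p ^ i)"
    by (simp add: power_p_power)
  hence "\<exists>e. e > 0 \<and> x ^ (p ^ e) = x"
    using ij(1) by (intro exI[of _ "j - i"]) (simp add: frobenius_inj)
  define e where "e = (LEAST e. e > 0 \<and> x ^ (p ^ e) = x)"
  have e: "e > 0" "x ^ (p ^ e) = x"
    using LeastI_ex[OF \<open>\<exists>e. e > 0 \<and> x ^ (p ^ e) = x\<close>] by (simp_all add: e_def)
  have least: "r \<ge> e" if "r > 0" "x ^ (p ^ r) = x" for r
    unfolding e_def using that by (intro Least_le) simp
  have fix_iff: "x \<in> Fq r \<longleftrightarrow> e dvd r" for r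
  proof
    assume "x \<in> Fq r"
    hence "x ^ (p ^ (r div e * e + r mod e)) = x" by (simp add: Fq_def)
    hence "x ^ (p ^ (r mod e)) = x"
      by (simp only: power_p_power[symmetric] orb_mult(1)[OF e(2)])
    hence "r mod e = 0"
      using least[of "r mod e"] mod_less_divisor[OF e(1), of r] by (cases "r mod e = 0") auto
    thus "e dvd r" by presburger
  next
    assume "e dvd r"
    thus "x \<in> Fq r" using orb_mult(1)[OF e(2)] by (auto simp: Fq_def mult.commute)
  qed
  have inj: "inj_on (\<lambda>i. x ^ (p ^ i)) {..<e}"
  proof (rule linorder_inj_onI')
    fix i j assume ij: "i \<in> {..<e}" "j \<in> {..<e}" "i < j"
    show "x ^ (p ^ i) \<noteq> x ^ (p ^ j)"
    proof
      assume "x ^ (p ^ i) = x ^ (p ^ j)"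
      hence "(x ^ (p ^ (j - i))) ^ (p ^ i) = x ^ (p ^ i)"
        using ij by (simp add: power_p_power)
      hence "e \<le> j - i" using ij by (intro least) (simp_all add: frobenius_inj)
      thus False using ij e(1) by auto
    qed
  qed
  have orb_e: "orb e x = mset_set ((\<lambda>i. x ^ (p ^ i)) ` {..<e})"
    using inj by (simp add: orb_def image_mset_mset_set)
  have sub_iff: "orb (i * e) x \<subseteq># A \<longleftrightarrow> i \<le> o'" for i
  proof
    assume "orb (i * e) x \<subseteq># A"
    hence "count (orb (i * e) x) x \<le> o'"
      by (simp add: o'_def mset_subset_eq_count)
    moreover have "x \<in> (\<lambda>i. x ^ (p ^ i)) ` {..<e}"
      using e(1) by (intro image_eqI[of _ _ 0]) auto
    ultimately show "i \<le> o'"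
      by (simp add: orb_mult[OF e(2)] orb_e)
  next
    assume "i \<le> o'"
    thus "orb (i * e) x \<subseteq># A"
      by (intro mset_subset_eqI)
         (auto simp: orb_mult[OF e(2)] orb_e count_mset_set' o'_def count_frobenius[OF A])
  qed
  have "{r \<in> {1..m}. x \<in> Fq r \<and> orb r x \<subseteq># A} = (\<lambda>i. i * e) ` {1..o'}"
  proof (intro equalityI subsetI)
    fix r assume "r \<in> {r \<in> {1..m}. x \<in> Fq r \<and> orb r x \<subseteq># A}"
    hence r: "r \<ge> 1" "e dvd r" "orb r x \<subseteq># A" by (auto simp: fix_iff)
    then obtain i where "r = i * e" by (metis dvd_div_mult_self)
    with r show "r \<in> (\<lambda>i. i * e) ` {1..o'}" by (auto simp: sub_iff)
  next
    fix r assume "r \<in> (\<lambda>i. i * e) ` {1..o'}"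
    then obtain i where "r = i * e" "i \<in> {1..o'}" by (rule imageE)
    hence i: "r = i * e" "1 \<le> i" "i \<le> o'" by auto
    hence sub: "orb r x \<subseteq># A" by (simp add: sub_iff)
    from size_mset_mono[OF this] have "r \<le> m" using A by (simp add: frob_msets_def)
    with i e(1) sub show "r \<in> {r \<in> {1..m}. x \<in> Fq r \<and> orb r x \<subseteq># A}"
      by (auto simp: fix_iff)
  qed
  also have "card \<dots> = o'"
    using e(1) by (subst card_image) (auto simp: inj_on_def)
  finally show ?thesis by (simp add: o'_def)
qed

text \<open>Positive multiplicity makes the set in \<open>card_orb_subset\<close> nonempty. This
  confines all members to a finite set, whence \<open>finite_frob_msets\<close>.\<close>

lemma frob_msets_elem_in_Fq:
  assumes "A \<in> frob_msets m" "x \<in># A"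
  shows "\<exists>r\<in>{1..m}. x \<in> Fq r"
proof -
  have "card {r \<in> {1..m}. x \<in> Fq r \<and> orb r x \<subseteq># A} \<noteq> 0"
    unfolding card_orb_subset[OF assms(1)] using assms(2) by simp
  hence "{r \<in> {1..m}. x \<in> Fq r \<and> orb r x \<subseteq># A} \<noteq> {}"
    by (metis card.empty)
  thus ?thesis by blast
qed

lemma finite_frob_msets: "finite (frob_msets m)"
proof -
  define U where "U = (\<Union>r\<in>{1..m}. Fq r)"
  have "finite U" by (auto simp: U_def card_Fq)
  have "frob_msets m \<subseteq> mset ` {xs. set xs \<subseteq> U \<and> length xs = m}"
  proof
    fix A assume A: "A \<in> frob_msets m"
    obtain xs where "mset xs = A" using ex_mset by blast
    with A frob_msets_elem_in_Fq[OF A] show "A \<in> mset ` {xs. set xs \<subseteq> U \<and> length xs = m}"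
      by (intro image_eqI[of _ _ xs]) (auto simp: frob_msets_def U_def)
  qed
  thus ?thesis
    by (rule finite_subset) (intro finite_imageI finite_lists_length_eq \<open>finite U\<close>)
qed

lemma frob_msets_0: "frob_msets 0 = {{#}}"
  by (auto simp: frob_msets_def)

text \<open>Counting the pairs of a multiset and one of its elements (with multiplicity)
  via \<open>card_orb_subset\<close> is the logarithmic derivative of the Euler product.\<close>
lemma frob_msets_recurrence:
  fixes lam :: "'k multiset \<Rightarrow> complex"
  assumes lam: "\<And>m n A B. A \<in> frob_msets m \<Longrightarrow> B \<in> frob_msets n \<Longrightarrow> lam (A + B) = lam A * lam B"
  shows "of_nat m * (\<Sum>A\<in>frob_msets m. lam A) = 
         (\<Sum>r=1..m. (\<Sum>x\<in>Fq r. lam (orb r x)) * (\<Sum>A\<in>frob_msets (m - r). lam A))"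
proof -
  define U where "U = (\<Union>r\<in>{1..m}. Fq r)"
  have U: "finite U" by (auto simp: U_def card_Fq)
  have size: "of_nat m = (\<Sum>x\<in>U. \<Sum>r=1..m. if x \<in> Fq r \<and> orb r x \<subseteq># A then 1 else (0::complex))"
    if A: "A \<in> frob_msets m" for A
  proof -
    have "m = (\<Sum>x\<in>set_mset A. count A x)" using A by (simp add: frob_msets_def size_multiset_overloaded_eq)
    also have "\<dots> = (\<Sum>x\<in>U. count A x)"
      using U frob_msets_elem_in_Fq[OF A]
      by (intro sum.mono_neutral_left) (auto simp: U_def not_in_iff)
    also have "\<dots> = (\<Sum>x\<in>U. card {r \<in> {1..m}. x \<in> Fq r \<and> orb r x \<subseteq># A})"
      by (simp only: card_orb_subset[OF A])
    also have "of_nat \<dots> = (\<Sum>x\<in>U. \<Sum>r=1..m. if x \<in> Fq r \<and> orb r x \<subseteq># A then 1 else (0::complex))"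
      by (simp add: sum.If_cases Int_def)
    finally show ?thesis .
  qed
  \<comment> \<open>Removing \<open>orb r x\<close> maps the multisets containing it bijectively
    onto \<open>frob_msets (m - r)\<close>, and \<open>lam\<close> is multiplicative.\<close>
  have inner: "(\<Sum>A\<in>{A\<in>frob_msets m. orb r x \<subseteq># A}. lam A) = lam (orb r x) * (\<Sum>A\<in>frob_msets (m - r). lam A)"
    if r: "r \<in> {1..m}" "x \<in> Fq r" for r x
  proof -
    have "(\<Sum>A\<in>{A\<in>frob_msets m. orb r x \<subseteq># A}. lam A) = (\<Sum>B\<in>frob_msets (m - r). lam (orb r x + B))"
      using frob_msets_add[OF orb_in_frob_msets[OF r(2)], of _ "m - r"] frob_msets_diff[OF _ orb_in_frob_msets[OF r(2)], of _ m] r(1)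
      by (intro sum.reindex_bij_witness[of _ "\<lambda>B. orb r x + B" "\<lambda>A. A - orb r x"]) auto
    also have "\<dots> = lam (orb r x) * (\<Sum>A\<in>frob_msets (m - r). lam A)"
      by (simp add: sum_distrib_left lam[OF orb_in_frob_msets[OF r(2)]])
    finally show ?thesis .
  qed
  have "of_nat m * (\<Sum>A\<in>frob_msets m. lam A) = 
      (\<Sum>A\<in>frob_msets m. \<Sum>x\<in>U. \<Sum>r=1..m. if x \<in> Fq r \<and> orb r x \<subseteq># A then lam A else 0)"
    unfolding sum_distrib_left
    by (intro sum.cong refl, subst size, assumption)
       (auto simp: sum_distrib_right intro!: sum.cong)
  also have "\<dots> = (\<Sum>r=1..m. \<Sum>x\<in>U. \<Sum>A\<in>frob_msets m. if x \<in> Fq r \<and> orb r x \<subseteq># A then lam A else 0)"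
    by (subst sum.swap, subst (2) sum.swap, rule sum.swap)
  also have "\<dots> = (\<Sum>r=1..m. \<Sum>x\<in>Fq r. \<Sum>A\<in>{A\<in>frob_msets m. orb r x \<subseteq># A}. lam A)"
  proof (rule sum.cong[OF refl])
    fix r assume r: "r \<in> {1..m}"
    have "(\<Sum>x\<in>U. \<Sum>A\<in>frob_msets m. if x \<in> Fq r \<and> orb r x \<subseteq># A then lam A else 0)
        = (\<Sum>x\<in>Fq r. \<Sum>A\<in>frob_msets m. if x \<in> Fq r \<and> orb r x \<subseteq># A then lam A else 0)"
      using U r by (intro sum.mono_neutral_right) (auto simp: U_def)
    also have "\<dots> = (\<Sum>x\<in>Fq r. \<Sum>A\<in>{A\<in>frob_msets m. orb r x \<subseteq># A}. lam A)"
      by (rule sum.cong[OF refl]) (simp add: sum.inter_filter[OF finite_frob_msets])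
    finally show "(\<Sum>x\<in>U. \<Sum>A\<in>frob_msets m. if x \<in> Fq r \<and> orb r x \<subseteq># A then lam A else 0)
        = (\<Sum>x\<in>Fq r. \<Sum>A\<in>{A\<in>frob_msets m. orb r x \<subseteq># A}. lam A)" .
  qed
  also have "\<dots> = (\<Sum>r=1..m. (\<Sum>x\<in>Fq r. lam (orb r x)) * (\<Sum>A\<in>frob_msets (m - r). lam A))"
    by (simp add: inner sum_distrib_right)
  finally show ?thesis .
qed

end

section \<open>The L-function is a polynomial\<close>

definition psum :: "'a::field multiset \<Rightarrow> nat \<Rightarrow> 'a" where
  "psum A k = (\<Sum>a\<in>#A. a ^ k)"

definition euler_fps :: "'a::field multiset \<Rightarrow> 'a fps" where
  "euler_fps A = (\<Prod>a\<in>#A. 1 - fps_const a * fps_X)"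

lemma euler_fps_simps [simp]:
  "euler_fps {#} = 1" "euler_fps (add_mset a A) = (1 - fps_const a * fps_X) * euler_fps A"
  by (simp_all add: euler_fps_def)

text \<open>Logarithmic derivative, multiplied out: the factor of \<open>a\<close> contributes
  \<open>- a / (1 - a T)\<close>, whose coefficients are \<open>- a ^ Suc k\<close>.\<close>

lemma fps_deriv_euler_fps:
  "fps_deriv (euler_fps A) = - (euler_fps A * Abs_fps (\<lambda>k. psum A (Suc k)))"
proof (induction A)
  case empty
  thus ?case by (simp add: psum_def fps_eq_iff fps_mult_nth)
next
  case (add a A)
  have 1: "(1 - fps_const a * fps_X) * Abs_fps (\<lambda>k. a ^ Suc k) = fps_const a"
  proof (rule fps_ext)
    fix n show "((1 - fps_const a * fps_X) * Abs_fps (\<lambda>k. a ^ Suc k)) $ n = fps_const a $ n"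
      by (cases n) (simp_all add: left_diff_distrib mult.assoc)
  qed
  have 2: "Abs_fps (\<lambda>k. psum (add_mset a A) (Suc k)) = 
      Abs_fps (\<lambda>k. a ^ Suc k) + Abs_fps (\<lambda>k. psum A (Suc k))"
    by (simp add: psum_def fps_eq_iff)
  have "fps_deriv (euler_fps (add_mset a A)) = 
      - (fps_const a * euler_fps A) - (1 - fps_const a * fps_X) * (euler_fps A * Abs_fps (\<lambda>k. psum A (Suc k)))"
    by (simp add: add algebra_simps)
  also have "\<dots> = - (euler_fps (add_mset a A) * Abs_fps (\<lambda>k. psum (add_mset a A) (Suc k)))"
    unfolding 2 by (subst 1[symmetric]) (simp add: algebra_simps)
  finally show ?case .
qed

lemma euler_fps_nth:
  "euler_fps A $ l = (if l \<le> size A then coeff (\<Prod>a\<in>#A. [:-a, 1:]) (size A - l) else 0)"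
proof (induction A arbitrary: l)
  case (add a A)
  define P where "P = (\<Prod>a\<in>#A. [:-a, 1:])"
  have deg: "degree P = size A" and lc: "coeff P (size A) = 1"
    using degree_prod_mset_linear[of A] lead_coeff_prod_mset_linear[of A] by (simp_all add: P_def)
  have nth: "euler_fps (add_mset a A) $ l = euler_fps A $ l - (if l = 0 then 0 else a * euler_fps A $ (l - 1))"
    by (simp add: left_diff_distrib mult.assoc)
  have cf: "coeff (\<Prod>a\<in>#add_mset a A. [:-a, 1:]) n = (if n = 0 then 0 else coeff P (n - 1)) - a * coeff P n" for n
    by (cases n) (simp_all add: P_def)
  show ?case
    unfolding nth cf add P_def[symmetric]
    using deg lc coeff_eq_0[of P "Suc (size A)"] by (cases l) (auto simp: Suc_diff_le not_le le_Suc_eq)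
qed auto

lemma euler_fps_nth_0 [simp]: "euler_fps A $ 0 = 1"
  by (induction A) auto

text \<open>Comparison of the coefficients of \<open>T^(k - 1)\<close> in
  \<open>fps_deriv_euler_fps\<close>. Nothing is divided by \<open>k\<close>, so it holds in
  characteristic \<open>p\<close> too.\<close>

lemma newton_identity:
  assumes "k > 0"
  shows "psum A k = - (of_nat k * euler_fps A $ k + (\<Sum>i=1..<k. euler_fps A $ i * psum A (k - i)))"
proof -
  obtain n where n: "k = Suc n" using assms by (cases k) auto
  have "fps_deriv (euler_fps A) $ n = - (euler_fps A * Abs_fps (\<lambda>k. psum A (Suc k))) $ n"
    by (simp add: fps_deriv_euler_fps)
  hence "of_nat k * euler_fps A $ k = - (\<Sum>i=0..n. euler_fps A $ i * psum A (Suc (n - i)))"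
    by (simp add: n fps_mult_nth)
  also have "(\<Sum>i=0..n. euler_fps A $ i * psum A (Suc (n - i))) = (\<Sum>i=0..n. euler_fps A $ i * psum A (k - i))"
    by (intro sum.cong) (auto simp: n Suc_diff_le)
  also have "\<dots> = psum A k + (\<Sum>i=1..<k. euler_fps A $ i * psum A (k - i))"
    by (simp add: sum.atLeast_Suc_atMost n atLeastLessThanSuc_atLeastAtMost)
  finally show ?thesis by (simp add: algebra_simps)
qed

lemma psum_eq_below:
  assumes "\<And>i. i < d \<Longrightarrow> euler_fps A $ i = euler_fps B $ i"
  shows "0 < k \<Longrightarrow> k < d \<Longrightarrow> psum A k = psum B k"
proof (induction k rule: less_induct)
  case (less k)
  thus ?case
    by (simp add: newton_identity[of k] assms)
qed

text \<open>In Newton's identity of order \<open>d\<close> only the term with the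
  \<open>d\<close>-th coefficient can differ; lower coefficients and power sums agree by
  \<open>psum_eq_below\<close>.\<close>

lemma psum_diff_at:
  assumes "d > 0" "\<And>i. i < d \<Longrightarrow> euler_fps A $ i = euler_fps B $ i"
  shows "psum A d - psum B d = - of_nat d * (euler_fps A $ d - euler_fps B $ d)"
proof -
  have "(\<Sum>i=1..<d. euler_fps A $ i * psum A (d - i)) = (\<Sum>i=1..<d. euler_fps B $ i * psum B (d - i))"
    by (intro sum.cong refl) (simp add: assms psum_eq_below[OF assms(2)])
  thus ?thesis using assms(1) by (simp add: newton_identity[of d] algebra_simps)
qed

lemma sum_mset_poly_psum:
  "(\<Sum>a\<in>#A. poly F a) = (\<Sum>i\<le>degree F. coeff F i * psum A i)"
  by (induction A) (simp_all add: psum_def poly_altdef sum.distrib ring_distribs)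

section \<open>Multisets as monic polynomials over the prime field\<close>

context prime_char
begin

abbreviation root_poly :: "'k multiset \<Rightarrow> 'k poly" where
  "root_poly A \<equiv> \<Prod>a\<in>#A. [:-a, 1:]"

lemma coeff_root_poly_frobenius:
  "coeff (root_poly A) i ^ p = coeff (root_poly (image_mset (\<lambda>x. x ^ p) A)) i"
proof (induction A arbitrary: i)
  case empty
  show ?case using p_gt_0 by (simp add: coeff_1)
next
  case (add a A)
  have cf: "coeff (root_poly (add_mset a A)) n = (if n = 0 then 0 else coeff (root_poly A) (n - 1)) - a * coeff (root_poly A) n" for n a A
    by (cases n) simp_all
  have "coeff (root_poly (add_mset a A)) i ^ p = 
      (if i = 0 then 0 else coeff (root_poly A) (i - 1)) ^ p - (a * coeff (root_poly A) i) ^ p"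
    unfolding cf using frobenius_diff[of _ _ 1] by simp
  also have "\<dots> = coeff (root_poly (add_mset (a ^ p) (image_mset (\<lambda>x. x ^ p) A))) i"
    unfolding cf using p_gt_0 by (simp add: power_mult_distrib add)
  finally show ?case by simp
qed

lemma root_poly_inject: "root_poly A = root_poly B \<longleftrightarrow> A = B"
  by (metis proots_prod_mset_linear)

text \<open>Frobenius on the roots induces Frobenius on the coefficients, and a monic split
  polynomial determines its root multiset.\<close>

lemma frob_msets_iff: "A \<in> frob_msets m \<longleftrightarrow> size A = m \<and> (\<forall>i. coeff (root_poly A) i \<in> Fq 1)"
proof -
  have "image_mset (\<lambda>x. x ^ p) A = A \<longleftrightarrow> root_poly (image_mset (\<lambda>x. x ^ p) A) = root_poly A"
    by (simp only: root_poly_inject)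
  also have "\<dots> \<longleftrightarrow> (\<forall>i. coeff (root_poly A) i \<in> Fq 1)"
    unfolding poly_eq_iff coeff_root_poly_frobenius[symmetric] by (simp add: Fq_def)
  finally show ?thesis by (simp add: frob_msets_def)
qed

text \<open>Adds \<open>t X^(m - d)\<close> to the monic polynomial. In the reversed polynomial
  \<open>euler_fps A\<close> this adds \<open>t\<close> to the coefficient of \<open>T^d\<close> and
  keeps those below it.\<close>

definition shift :: "nat \<Rightarrow> nat \<Rightarrow> 'k \<Rightarrow> 'k multiset \<Rightarrow> 'k multiset" where
  "shift m d t A = proots (root_poly A + monom t (m - d))"

lemma root_poly_shift:
  assumes "size A = m" "0 < d" "d \<le> m"
  shows "root_poly (shift m d t A) = root_poly A + monom t (m - d)" "size (shift m d t A) = m"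
proof -
  let ?Q = "root_poly A + monom t (m - d)"
  have "degree (monom t (m - d)) < degree (root_poly A)"
    using assms by (intro le_less_trans[OF degree_monom_le]) (simp add: degree_prod_mset_linear)
  hence "degree ?Q = degree (root_poly A)" by (rule degree_add_eq_left)
  hence deg: "degree ?Q = m" using assms by (simp add: degree_prod_mset_linear)
  have lc: "lead_coeff ?Q = 1"
    using assms lead_coeff_prod_mset_linear[of A] by (simp add: deg degree_prod_mset_linear coeff_monom)
  hence "?Q \<noteq> 0" by (metis coeff_0 zero_neq_one)
  from alg_closed_poly_eq_prod_proots[OF this] deg lc
  show "root_poly (shift m d t A) = ?Q" "size (shift m d t A) = m" by (simp_all add: shift_def)
qed

lemma shift_in_frob_msets:
  assumes "A \<in> frob_msets m" "0 < d" "d \<le> m" "t \<in> Fq 1"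
  shows "shift m d t A \<in> frob_msets m"
  using assms root_poly_shift[of A m d t] unfolding frob_msets_iff by (auto intro!: Fq_add simp: coeff_monom)

lemma shift_shift:
  assumes "A \<in> frob_msets m" "0 < d" "d \<le> m"
  shows "shift m d (- t) (shift m d t A) = A"
proof -
  have "size A = m" using assms by (simp add: frob_msets_def)
  from root_poly_shift[OF this assms(2,3)] show ?thesis
    by (simp add: shift_def[of m d "- t"] proots_prod_mset_linear minus_monom[symmetric] del: minus_monom)
qed

lemma euler_fps_shift:
  assumes "A \<in> frob_msets m" "0 < d" "d \<le> m" "l \<le> d"
  shows "euler_fps (shift m d t A) $ l = euler_fps A $ l + (if l = d then t else 0)"
proof -
  have "size A = m" using assms by (simp add: frob_msets_def)
  from root_poly_shift[OF this assms(2,3)] \<open>size A = m\<close> assms(2-4) show ?thesis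
    by (auto simp: euler_fps_nth coeff_monom)
qed

end

section \<open>Weights and the L-polynomial of an exponential sum\<close>

locale weil_sum = prime_char p K 
  for p :: nat and K :: "'k::{alg_closed_field,field_prime_char} itself" +
  fixes f :: "int poly" and d :: nat
  assumes d_def: "d = degree f" and d_pos: "0 < d" and d_less: "d < p"
    and lead: "\<not> int p dvd lead_coeff f"
begin

definition F :: "'k poly" where "F = map_poly of_int f"

lemma coeff_F: "coeff F i = of_int (coeff f i)"
  by (simp add: F_def coeff_map_poly)

lemma coeff_F_d: "coeff F d \<noteq> 0"
  using lead by (simp add: coeff_F of_int_eq_0_iff_char_dvd p_eq d_def)

lemma degree_F: "degree F = d"
proof (rule antisym)
  show "degree F \<le> d" unfolding d_def F_def by (rule degree_map_poly_le)
  show "d \<le> degree F" by (rule le_degree) (rule coeff_F_d)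
qed

lemma poly_F_frobenius: "poly F (x ^ (p ^ i)) = poly F x ^ (p ^ i)"
proof -
  have c: "coeff F j ^ (p ^ i) = coeff F j" for j
    using of_int_in_Fq[of "coeff f j"] 
    by (induction i) (simp_all add: coeff_F Fq_def power_mult mult.commute)
  show ?thesis
    by (simp add: poly_altdef frobenius_sum power_mult_distrib c power_mult[symmetric] mult.commute)
qed

lemma poly_F_in_Fq: "x \<in> Fq r \<Longrightarrow> poly F x \<in> Fq r"
  by (simp add: Fq_def flip: poly_F_frobenius)

text \<open>Adding multisets multiplies polynomials, so by \<open>weight_add\<close> this is
  completely multiplicative on monic polynomials over the prime field.\<close>

definition weight :: "'k multiset \<Rightarrow> complex" where
  "weight A = psi (\<Sum>a\<in>#A. poly F a)"

definition char_sum :: "nat \<Rightarrow> complex" where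
  "char_sum r = (\<Sum>x\<in>Fq r. psi (trace r (poly F x)))"

lemma sum_F_in_Fq1:
  assumes "A \<in> frob_msets m"
  shows "(\<Sum>a\<in>#A. poly F a) \<in> Fq 1"
proof -
  have "(\<Sum>a\<in>#B. poly F a) ^ p = (\<Sum>a\<in>#image_mset (\<lambda>x. x ^ p) B. poly F a)" for B
    using poly_F_frobenius[of _ 1] frobenius_add[of _ _ 1] p_gt_0 by (induction B) simp_all
  from this[of A] assms show ?thesis by (simp add: frob_msets_def Fq_def)
qed

lemma weight_add: "A \<in> frob_msets m \<Longrightarrow> B \<in> frob_msets n \<Longrightarrow> weight (A + B) = weight A * weight B"
  using psi_add[OF sum_F_in_Fq1 sum_F_in_Fq1] by (simp add: weight_def)

text \<open>\<open>F\<close> commutes with Frobenius, so summing it over the orbit gives a trace.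
  This turns the sums over \<open>Fq r\<close> in \<open>frob_msets_recurrence\<close> into
  \<open>char_sum r\<close>.\<close>

lemma weight_orb: "weight (orb r x) = psi (trace r (poly F x))"
  by (simp add: weight_def orb_def trace_def image_mset.compositionality o_def poly_F_frobenius sum_unfold_sum_mset)

definition weight_sum :: "nat \<Rightarrow> complex" where "weight_sum m = (\<Sum>A\<in>frob_msets m. weight A)"

lemma weight_sum_0: "weight_sum 0 = 1"
  by (simp add: weight_sum_def frob_msets_0 weight_def)

text \<open>The sum of \<open>F\<close> over a multiset is a linear combination of power sums of
  order at most \<open>d\<close>. The shift keeps those below \<open>d\<close> and changes the
  \<open>d\<close>-th by \<open>- of_nat d * t\<close>.\<close>

lemma weight_shift:
  assumes A: "A \<in> frob_msets m" and m: "d \<le> m" and t: "t \<in> Fq 1"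
  shows "weight (shift m d t A) = psi (- (coeff F d * of_nat d * t)) * weight A"
proof -
  let ?B = "shift m d t A"
  have E: "euler_fps ?B $ l = euler_fps A $ l + (if l = d then t else 0)" if "l \<le> d" for l
    using euler_fps_shift[OF A d_pos m that] .
  have B: "?B \<in> frob_msets m" by (rule shift_in_frob_msets[OF A d_pos m t])
  have "(\<Sum>a\<in>#?B. poly F a) - (\<Sum>a\<in>#A. poly F a) = (\<Sum>i\<le>d. coeff F i * (psum ?B i - psum A i))"
    by (simp add: sum_mset_poly_psum degree_F sum_subtractf ring_distribs)
  also have "\<dots> = (\<Sum>i\<in>{d}. coeff F i * (psum ?B i - psum A i))"
  proof (rule sum.mono_neutral_right)
    show "\<forall>i\<in>{..d} - {d}. coeff F i * (psum ?B i - psum A i) = 0"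
    proof
      fix i assume i: "i \<in> {..d} - {d}"
      have "psum ?B i = psum A i"
      \<comment> \<open>Order 0 is the size, which Newton's identities do not reach.\<close>
      proof (cases "i = 0")
        case True
        thus ?thesis using A B by (simp add: psum_def frob_msets_def)
      next
        case False
        thus ?thesis using i by (intro psum_eq_below[of d]) (auto simp: E)
      qed
      thus "coeff F i * (psum ?B i - psum A i) = 0" by simp
    qed
  qed auto
  also have "\<dots> = - (coeff F d * of_nat d * t)"
    using psum_diff_at[of d ?B A] d_pos by (simp add: E)
  finally have "(\<Sum>a\<in>#?B. poly F a) = - (coeff F d * of_nat d * t) + (\<Sum>a\<in>#A. poly F a)"
    by (simp add: algebra_simps)
  moreover have "- (coeff F d * of_nat d * t) \<in> Fq 1"
    using of_int_in_Fq[of "int d"] of_int_in_Fq[of "lead_coeff f"] t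
    by (intro Fq_uminus Fq_mult) (simp_all add: coeff_F d_def)
  ultimately show ?thesis
    unfolding weight_def using psi_add sum_F_in_Fq1[OF A] by (simp only:)
qed

text \<open>Adding \<open>t X^{m-d}\<close> to the monic polynomial of degree \<open>m\<close> multiplies its weight by a fixed
  value of the additive character, which is not 1 for a suitable \<open>t\<close>.\<close>
lemma weight_sum_eq_0:
  assumes m: "d \<le> m"
  shows "weight_sum m = 0"
proof -
  have d0: "of_nat d \<noteq> (0 :: 'k)"
    using d_pos d_less by (auto simp: of_nat_eq_0_iff_char_dvd p_eq[symmetric] dest: dvd_imp_le)
  \<comment> \<open>Chosen to make the factor in \<open>weight_shift\<close> equal to
    \<open>psi 1\<close>; \<open>d < p\<close> permits the division by
    \<open>of_nat d\<close>.\<close>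
  define t where "t = - (1 / (coeff F d * of_nat d))"
  have "coeff F d \<in> Fq 1" using of_int_in_Fq by (simp only: coeff_F)
  moreover have "of_nat d \<in> Fq 1" using of_int_in_Fq[of "int d"] by simp
  ultimately have t: "t \<in> Fq 1" 
    unfolding t_def by (intro Fq_uminus Fq_divide Fq_mult Fq_1)
  hence t': "- t \<in> Fq 1" by (rule Fq_uminus)
  have 1: "- (coeff F d * of_nat d * t) = 1"
    using d0 coeff_F_d by (simp add: t_def)
  have "weight_sum m = (\<Sum>A\<in>frob_msets m. weight (shift m d t A))"
    unfolding weight_sum_def
    using shift_shift[OF _ d_pos m] shift_shift[OF _ d_pos m, of _ "- t"]
          shift_in_frob_msets[OF _ d_pos m] t t'
    by (intro sum.reindex_bij_witness[of _ "shift m d t" "shift m d (- t)"]) auto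
  also have "\<dots> = psi 1 * weight_sum m"
    unfolding weight_sum_def sum_distrib_left by (intro sum.cong refl) (simp add: weight_shift[OF _ m t] 1)
  finally show ?thesis using psi_1_neq by simp
qed

text \<open>The generating series of \<open>weight_sum\<close> has constant term 1 and no terms from
  degree \<open>d\<close> on, so it is a product of \<open>d - 1\<close> factors
  \<open>1 - w T\<close>. Its logarithmic derivative generates the \<open>char_sum\<close> by
  \<open>frob_msets_recurrence\<close> and the negated power sums by
  \<open>fps_deriv_euler_fps\<close>.\<close>

lemma char_sum_eq_psum: "\<exists>W :: complex multiset. size W = d - 1 \<and> (\<forall>r>0. char_sum r = - psum W r)"
proof -
  \<comment> \<open>The series reversed in degree \<open>d - 1\<close>: monic, with the reciprocal
    roots as roots. Roots equal to 0 are harmless.\<close>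
  define R where "R = (\<Sum>i<d. monom (weight_sum (d - 1 - i)) i)"
  have cR: "coeff R i = (if i < d then weight_sum (d - 1 - i) else 0)" for i
    by (simp add: R_def coeff_sum coeff_monom)
  have degR: "degree R = d - 1"
  proof (rule antisym)
    show "degree R \<le> d - 1" by (rule degree_le) (auto simp: cR)
    show "d - 1 \<le> degree R" by (rule le_degree) (use d_pos in \<open>simp add: cR weight_sum_0\<close>)
  qed
  have lcR: "lead_coeff R = 1" using d_pos by (simp add: degR cR weight_sum_0)
  hence "R \<noteq> 0" by auto
  define W where "W = proots R"
  have W: "R = (\<Prod>a\<in>#W. [:-a, 1:])" "size W = d - 1"
    using alg_closed_poly_eq_prod_proots[OF \<open>R \<noteq> 0\<close>] lcR degR by (simp_all add: W_def)
  have EW: "euler_fps W = Abs_fps weight_sum"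
  proof (rule fps_ext)
    fix n
    show "euler_fps W $ n = Abs_fps weight_sum $ n"
      using d_pos weight_sum_eq_0[of n] by (auto simp: euler_fps_nth W(2) W(1)[symmetric] cR)
  qed
  have "fps_deriv (Abs_fps weight_sum) = Abs_fps weight_sum * Abs_fps (\<lambda>k. char_sum (Suc k))"
  proof (rule fps_ext)
    fix n
    have "of_nat (Suc n) * weight_sum (Suc n) = (\<Sum>r=1..Suc n. char_sum r * weight_sum (Suc n - r))"
      unfolding weight_sum_def char_sum_def weight_orb[symmetric]
      by (rule frob_msets_recurrence) (rule weight_add)
    also have "\<dots> = (\<Sum>i=0..n. char_sum (Suc i) * weight_sum (n - i))"
      using sum.shift_bounds_cl_Suc_ivl[of "\<lambda>r. char_sum r * weight_sum (Suc n - r)" 0 n] by simp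
    also have "\<dots> = (Abs_fps (\<lambda>k. char_sum (Suc k)) * Abs_fps weight_sum) $ n"
      by (simp add: fps_mult_nth)
    finally show "fps_deriv (Abs_fps weight_sum) $ n = (Abs_fps weight_sum * Abs_fps (\<lambda>k. char_sum (Suc k))) $ n"
      by (simp add: mult.commute)
  qed
  moreover have "fps_deriv (Abs_fps weight_sum) = Abs_fps weight_sum * (- Abs_fps (\<lambda>k. psum W (Suc k)))"
    using fps_deriv_euler_fps[of W] by (simp add: EW)
  moreover have "Abs_fps weight_sum \<noteq> 0" using weight_sum_0 by (auto simp: fps_eq_iff intro: exI[of _ 0])
  ultimately have "Abs_fps (\<lambda>k. char_sum (Suc k)) = - Abs_fps (\<lambda>k. psum W (Suc k))"
    by (metis mult_left_cancel)
  hence "char_sum (Suc k) = - psum W (Suc k)" for k by (simp add: fps_eq_iff)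
  hence "\<forall>r>0. char_sum r = - psum W r" by (metis gr0_conv_Suc)
  with W(2) show ?thesis by blast
qed

end

section \<open>Stepanov's method\<close>

text \<open>Gaussian elimination by induction on \<open>n\<close>, clearing the coefficient of
  degree \<open>n\<close> with a pivot. Bounding coefficients rather than degrees makes
  \<open>n = 0\<close> force zero polynomials.\<close>

lemma poly_linear_dependence:
  fixes v :: "'i \<Rightarrow> 'a::field poly"
  assumes "finite I" "card I > n" "\<And>i e. i \<in> I \<Longrightarrow> e \<ge> n \<Longrightarrow> coeff (v i) e = 0"
  shows "\<exists>b. (\<exists>i\<in>I. b i \<noteq> 0) \<and> (\<Sum>i\<in>I. smult (b i) (v i)) = 0"
  using assms
proof (induction n arbitrary: I v)
  case 0
  then obtain i where "i \<in> I" by fastforce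
  moreover have "v i = 0" if "i \<in> I" for i using 0(3)[OF that] by (simp add: poly_eq_iff)
  ultimately show ?case by (intro exI[of _ "\<lambda>_. 1"]) auto
next
  case (Suc n)
  show ?case
  proof (cases "\<forall>i\<in>I. coeff (v i) n = 0")
    case True
    have "\<And>i e. i \<in> I \<Longrightarrow> e \<ge> n \<Longrightarrow> coeff (v i) e = 0"
      using True Suc.prems(3) by (metis le_antisym not_less_eq_eq)
    thus ?thesis using Suc.IH[of I v] Suc.prems by auto
  next
    case False
    then obtain i0 where i0: "i0 \<in> I" "coeff (v i0) n \<noteq> 0" by auto
    define q where "q = (\<lambda>i. coeff (v i) n / coeff (v i0) n)"
    define v' where "v' = (\<lambda>i. v i - smult (q i) (v i0))"
    have "coeff (v' i) e = 0" if "i \<in> I - {i0}" "e \<ge> n" for i e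
    proof (cases "e = n")
      case True
      thus ?thesis using i0 by (simp add: v'_def q_def)
    next
      case False
      thus ?thesis using that Suc.prems(3) i0 by (simp add: v'_def)
    qed
    moreover have "card (I - {i0}) > n" using Suc.prems i0 by simp
    ultimately obtain b where b: "\<exists>i\<in>I-{i0}. b i \<noteq> 0" "(\<Sum>i\<in>I-{i0}. smult (b i) (v' i)) = 0"
      using Suc.IH[of "I - {i0}" v'] Suc.prems(1) by auto
    define b' where "b' = b(i0 := - (\<Sum>i\<in>I-{i0}. b i * q i))"
    have "(\<Sum>i\<in>I. smult (b' i) (v i)) = smult (b' i0) (v i0) + (\<Sum>i\<in>I-{i0}. smult (b i) (v i))"
      by (subst sum.remove[OF Suc.prems(1) i0(1)]) (auto simp: b'_def intro!: sum.cong)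
    also have "(\<Sum>i\<in>I-{i0}. smult (b i) (v i)) = 
        (\<Sum>i\<in>I-{i0}. smult (b i) (v' i) + smult (b i * q i) (v i0))"
      by (intro sum.cong) (simp_all add: v'_def smult_diff_right)
    also have "\<dots> = smult (\<Sum>i\<in>I-{i0}. b i * q i) (v i0)"
      by (simp add: sum.distrib b(2) smult_sum)
    finally have "(\<Sum>i\<in>I. smult (b' i) (v i)) = 0"
      by (simp add: b'_def)
    moreover have "\<exists>i\<in>I. b' i \<noteq> 0" using b(1) by (auto simp: b'_def)
    ultimately show ?thesis by blast
  qed
qed

text \<open>Among the terms with nonzero coefficient, the one of largest degree cannot
  cancel.\<close>

lemma sum_distinct_degrees_neq_0:
  fixes h :: "'i \<Rightarrow> 'a::field poly"
  assumes "finite I" "inj_on (\<lambda>i. degree (h i)) I" "\<And>i. i \<in> I \<Longrightarrow> h i \<noteq> 0" "\<exists>i\<in>I. b i \<noteq> 0"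
  shows "(\<Sum>i\<in>I. smult (b i) (h i)) \<noteq> 0"
proof -
  define J where "J = {i\<in>I. b i \<noteq> 0}"
  have J: "finite J" "J \<noteq> {}" using assms by (auto simp: J_def)
  have "Max ((\<lambda>i. degree (h i)) ` J) \<in> (\<lambda>i. degree (h i)) ` J"
    using J by (intro Max_in) auto
  then obtain i0 where i0: "i0 \<in> J" "degree (h i0) = Max ((\<lambda>i. degree (h i)) ` J)" by auto
  have max: "degree (h i) \<le> degree (h i0)" if "i \<in> J" for i
    unfolding i0(2) using J that by (intro Max_ge) auto
  have z: "coeff (smult (b i) (h i)) (degree (h i0)) = 0" if "i \<in> I - {i0}" for i
  proof (cases "i \<in> J")
    case True
    have "degree (h i) \<noteq> degree (h i0)"
      using that True i0(1) inj_onD[OF assms(2), of i i0] by (auto simp: J_def)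
    hence "degree (h i) < degree (h i0)" using max[OF True] by simp
    thus ?thesis by (simp add: coeff_eq_0)
  qed (use that in \<open>auto simp: J_def\<close>)
  have "i0 \<in> I" using i0(1) by (simp add: J_def)
  have "coeff (\<Sum>i\<in>I. smult (b i) (h i)) (degree (h i0)) = coeff (smult (b i0) (h i0)) (degree (h i0))
      + (\<Sum>i\<in>I - {i0}. coeff (smult (b i) (h i)) (degree (h i0)))"
    unfolding coeff_sum by (rule sum.remove[OF assms(1) \<open>i0 \<in> I\<close>])
  also have "\<dots> = coeff (smult (b i0) (h i0)) (degree (h i0))"
    using sum.neutral[of "I - {i0}"] z by (metis (no_types, lifting) add.right_neutral)
  also have "\<dots> \<noteq> 0" using i0(1) assms(3) by (auto simp: J_def)
  finally show ?thesis by auto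
qed

context weil_sum
begin

definition half_trace_poly :: "nat \<Rightarrow> 'k poly" where "half_trace_poly k = (\<Sum>i<k. F ^ (p ^ i))"

lemma degree_F_power: "degree (F ^ n) = d * n"
proof -
  have "F \<noteq> 0" using degree_F d_pos by auto
  thus ?thesis by (simp add: degree_power_eq degree_F)
qed

lemma degree_half_trace_poly: "degree (half_trace_poly (Suc n)) = d * p ^ n"
proof (induction n)
  case 0
  show ?case by (simp add: half_trace_poly_def degree_F)
next
  case (Suc n)
  have "degree (half_trace_poly (Suc n)) < degree (F ^ (p ^ Suc n))"
    using Suc d_pos p_gt_1 by (simp add: degree_F_power)
  hence "degree (half_trace_poly (Suc n) + F ^ (p ^ Suc n)) = degree (F ^ (p ^ Suc n))"
    by (rule degree_add_eq_right)
  thus ?case unfolding half_trace_poly_def by (simp only: sum.lessThan_Suc degree_F_power)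
qed

lemma poly_half_trace_poly: "poly (half_trace_poly k) x = (\<Sum>i<k. poly F x ^ (p ^ i))"
  by (simp add: half_trace_poly_def poly_sum)

text \<open>The upper half of the trace is the lower half raised to the power \<open>p ^ k\<close>;
  this is why only even degrees are treated.\<close>

lemma trace_double: "trace (2 * k) (poly F x) = poly (half_trace_poly k) x + poly (half_trace_poly k) x ^ (p ^ k)"
proof -
  have "trace (2 * k) (poly F x) = (\<Sum>i<k. poly F x ^ (p ^ i)) + (\<Sum>i<k. poly F x ^ (p ^ (k + i)))"
    unfolding trace_def mult_2
    by (subst sum.atLeastLessThan_concat[symmetric, of 0 k "k + k", unfolded atLeast0LessThan])
       (simp_all add: sum.shift_bounds_nat_ivl[of _ 0 k k, simplified] atLeast0LessThan add.commute)
  thus ?thesis by (simp add: poly_half_trace_poly frobenius_sum power_p_power add.commute)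
qed

text \<open>With \<open>Q = p^k\<close> and \<open>G = half_trace_poly k\<close>, elements \<open>x\<close> of \<open>Fq (2k)\<close> of trace \<open>a\<close> satisfy
  \<open>x^(Q^2) = x\<close> and \<open>G(x)^Q = a - G(x)\<close>. Hence a combination \<open>h\<close> of the polynomials \<open>X^u X^(Qi) G^j\<close>
  vanishes there as soon as \<open>\<Sum> b X^(uQ) X^i (a - G)^j = 0\<close> identically, where the \<open>b\<close> are the
  \<open>Q\<close>-th powers of the coefficients of \<open>h\<close>. This is a homogeneous linear system with more unknowns
  than equations, and \<open>h\<close> is nonzero because its terms have distinct degrees.\<close>
lemma stepanov_bound:
  assumes n: "P = p ^ n"
  defines "k \<equiv> Suc n"
  shows "card {x \<in> Fq (2 * k). trace (2 * k) (poly F x) = a} \<le> p * P\<^sup>2 + 2 * d * (p * P)"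
proof -
  define Q where "Q = p * P"
  have Q: "Q = p ^ k" by (simp add: Q_def n k_def)
  have P0: "P > 0" "Q > 0" using p_gt_0 by (auto simp: n Q)
  \<comment> \<open>The bounds on \<open>u\<close> and \<open>j\<close> let both be read off degrees
    modulo \<open>P\<close> and \<open>p\<close>; the \<open>d\<close> extra values of
    \<open>i\<close> make the unknowns outnumber the equations.\<close>
  define I where "I = {..<P} \<times> {..<P + d} \<times> {..<p}"
  have fin: "finite I" by (simp add: I_def)
  define v where "v = (\<lambda>(u, i, j). monom 1 (u * Q + i) * ([:a:] - half_trace_poly k) ^ j :: 'k poly)"
  define w where "w = (\<lambda>(u, i, j). monom 1 (u + Q * i) * half_trace_poly k ^ j :: 'k poly)"
  define N where "N = Suc ((P - 1) * Q + (P + d - 1) + (p - 1) * (d * P))"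
  have degG: "degree (half_trace_poly k) = d * P" by (simp add: k_def degree_half_trace_poly n)
  hence G0: "half_trace_poly k \<noteq> 0" using d_pos P0 by auto
  have deg_aG: "degree ([:a:] - half_trace_poly k) \<le> d * P"
    using degree_diff_le[of "[:a:]" "d * P" "half_trace_poly k"] degG by simp
  \<comment> \<open>All \<open>v t\<close> have degree below \<open>N\<close>, so \<open>N\<close>
    counts the equations. The number of unknowns \<open>P (P + d) p\<close> exceeds it by
    \<open>(Q - P) + d (P - 1)\<close>, positive as \<open>Q = p P\<close>.\<close>
  have cardI: "card I > N"
  proof -
    have "p = Suc (Suc (p - 2))" using p_gt_1 by simp
    then obtain p' where p': "p = Suc (Suc p')" by blast
    obtain P' where P': "P = Suc P'" using P0 by (cases P) auto
    obtain d' where d': "d = Suc d'" using d_pos by (cases d) auto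
    show ?thesis by (simp add: N_def I_def card_cartesian_product Q_def p' P' d' algebra_simps)
  qed
  have "coeff (v t) e = 0" if "t \<in> I" "e \<ge> N" for t e
  proof -
    obtain u i j where t: "t = (u, i, j)" "u < P" "i < P + d" "j < p"
      using \<open>t \<in> I\<close> by (auto simp: I_def)
    have "degree (v t) \<le> degree (monom (1::'k) (u * Q + i)) + degree (([:a:] - half_trace_poly k) ^ j)"
      unfolding v_def t by (simp only: prod.case degree_mult_le)
    also have "degree (([:a:] - half_trace_poly k) ^ j) \<le> degree ([:a:] - half_trace_poly k) * j" by (rule degree_power_le)
    also have "\<dots> \<le> d * P * j" using deg_aG by (rule mult_le_mono1)
    also have "\<dots> \<le> d * P * (p - 1)" using t by (intro mult_le_mono2) simp
    also have "degree (monom (1::'k) (u * Q + i)) = u * Q + i" by (simp add: degree_monom_eq)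
    also have "u * Q \<le> (P - 1) * Q" using t by (intro mult_le_mono1) simp
    also have "i \<le> P + d - 1" using t by simp
    finally have "degree (v t) < N" unfolding N_def by (simp add: mult.commute)
    thus ?thesis using \<open>e \<ge> N\<close> by (intro coeff_eq_0) simp
  qed
  hence "\<exists>b. (\<exists>t\<in>I. b t \<noteq> 0) \<and> (\<Sum>t\<in>I. smult (b t) (v t)) = 0"
    by (rule poly_linear_dependence[OF fin cardI])
  then
  obtain b where b: "\<exists>t\<in>I. b t \<noteq> 0" "(\<Sum>t\<in>I. smult (b t) (v t)) = 0" by (elim exE conjE)
  obtain r where r: "\<And>t. r t ^ Q = b t"
  proof -
    have "\<forall>t. \<exists>y. y ^ Q = b t" unfolding Q using frobenius_surj by blast
    thus ?thesis using that by (metis choice_iff)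
  qed
  have r0: "\<exists>t\<in>I. r t \<noteq> 0" using b(1) P0 by (metis r power_0_left not_gr_zero)
  define h where "h = (\<Sum>t\<in>I. smult (r t) (w t))"
  have degw: "degree (w (u, i, j)) = u + P * (p * i + d * j)" for u i j
    using G0 by (simp add: w_def degree_mult_eq degree_monom_eq degree_power_eq degG Q_def algebra_simps)
  have "h \<noteq> 0"
    unfolding h_def
  proof (rule sum_distinct_degrees_neq_0[OF fin _ _ r0])
    show "inj_on (\<lambda>t. degree (w t)) I"
    proof (rule inj_onI)
      fix t t' assume "t \<in> I" "t' \<in> I" and eq: "degree (w t) = degree (w t')"
      then obtain u i j u' i' j' where t: "t = (u, i, j)" "u < P" "j < p"
        and t': "t' = (u', i', j')" "u' < P" "j' < p"
        by (auto simp: I_def)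
      \<comment> \<open>The degree determines \<open>u\<close> modulo \<open>P\<close>, then
        \<open>j\<close> modulo \<open>p\<close> because \<open>d\<close> is prime to
        \<open>p\<close>, then \<open>i\<close>.\<close>
      have "u + P * (p * i + d * j) = u' + P * (p * i' + d * j')"
        using eq by (simp only: t t' degw)
      hence "(u + P * (p * i + d * j)) mod P = (u' + P * (p * i' + d * j')) mod P"
        and "(u + P * (p * i + d * j)) div P = (u' + P * (p * i' + d * j')) div P" by simp_all
      hence u: "u = u'" and ij: "p * i + d * j = p * i' + d * j'"
        using t t' P0 by simp_all
      have "(p * i + d * j) mod p = (p * i' + d * j') mod p" by (simp only: ij)
      hence "[d * j = d * j'] (mod p)" by (simp add: Cong.cong_def)
      moreover have "coprime d p"
        using d_pos d_less prime_p by (metis coprime_commute nat_dvd_not_less prime_imp_coprime)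
      ultimately have "[j = j'] (mod p)"
        by (simp add: cong_mult_lcancel_nat)
      hence "j = j'" using t t' by (simp add: cong_less_modulus_unique_nat)
      with ij p_gt_0 u show "t = t'" by (simp add: t t')
    qed
    show "w t \<noteq> 0" for t using G0 by (cases t) (simp add: w_def monom_eq_0_iff)
  qed
  have "degree h \<le> p * P\<^sup>2 + 2 * d * (p * P)"
    unfolding h_def
  proof (rule degree_sum_le[OF fin])
    fix t assume "t \<in> I"
    then obtain u i j where t: "t = (u, i, j)" "u < P" "i < P + d" "j < p"
      by (auto simp: I_def)
    have "degree (smult (r t) (w t)) \<le> degree (w t)" by (rule degree_smult_le)
    also have "\<dots> = u + P * (p * i + d * j)" by (simp only: t degw)
    also have "\<dots> \<le> P + P * (p * (P + d - 1) + d * p)"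
      using t by (intro add_mono mult_le_mono) auto
    also have "\<dots> = P + P * p * (P + d - 1) + P * d * p" by (simp add: algebra_simps)
    also have "\<dots> \<le> P * p * Suc (P + d - 1) + P * d * p"
      using p_gt_1 by simp
    also have "Suc (P + d - 1) = P + d" using P0 by simp
    finally show "degree (smult (r t) (w t)) \<le> p * P\<^sup>2 + 2 * d * (p * P)"
      by (simp add: algebra_simps power2_eq_square)
  qed
  have "{x \<in> Fq (2 * k). trace (2 * k) (poly F x) = a} \<subseteq> {x. poly h x = 0}"
  proof
    fix x assume "x \<in> {x \<in> Fq (2 * k). trace (2 * k) (poly F x) = a}"
    hence x: "x ^ (p ^ (2 * k)) = x" and "poly (half_trace_poly k) x + poly (half_trace_poly k) x ^ Q = a"
      by (simp_all only: Fq_def trace_double Q mem_Collect_eq)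
    hence trace: "poly (half_trace_poly k) x ^ Q = a - poly (half_trace_poly k) x" by (simp add: algebra_simps)
    have xQ: "x ^ (Q * Q) = x" using x by (simp add: Q mult_2 power_add)
    have "poly h x ^ Q = (\<Sum>t\<in>I. (r t * poly (w t) x) ^ Q)"
      by (simp add: h_def poly_sum Q frobenius_sum)
    also have "\<dots> = (\<Sum>t\<in>I. b t * poly (v t) x)"
    proof (intro sum.cong refl)
      fix t assume "t \<in> I"
      obtain u i j where t: "t = (u, i, j)" by (cases t)
      have "poly (w t) x ^ Q = x ^ (u * Q) * (x ^ (Q * Q)) ^ i * (poly (half_trace_poly k) x ^ Q) ^ j"
        by (simp add: t w_def poly_monom power_mult_distrib power_add power_mult[symmetric] algebra_simps)
      also have "\<dots> = poly (v t) x"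
        by (simp add: xQ trace t v_def poly_monom power_add algebra_simps)
      finally show "(r t * poly (w t) x) ^ Q = b t * poly (v t) x"
        by (simp add: power_mult_distrib r)
    qed
    also have "\<dots> = poly (\<Sum>t\<in>I. smult (b t) (v t)) x" by (simp add: poly_sum)
    finally show "x \<in> {x. poly h x = 0}" using b(2) P0 by simp
  qed
  hence "card {x \<in> Fq (2 * k). trace (2 * k) (poly F x) = a} \<le> card {x. poly h x = 0}"
    by (intro card_mono poly_roots_finite \<open>h \<noteq> 0\<close>)
  also have "\<dots> \<le> degree h" by (rule card_poly_roots_bound[OF \<open>h \<noteq> 0\<close>])
  finally show ?thesis using \<open>degree h \<le> _\<close> by simp
qed

text \<open>\<open>stepanov_bound\<close> bounds the counts \<open>N a\<close> only from above.
  Since \<open>psi\<close> sums to 0, each \<open>N a\<close> may be replaced by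
  \<open>N a - B\<close>, and in the total deficit \<open>p * B - p ^ (2 * Suc n)\<close> the main
  terms cancel.\<close>

lemma norm_char_sum_even: "norm (char_sum (2 * Suc n)) \<le> 2 * d * p * p ^ Suc n"
proof -
  let ?k = "Suc n"
  define P where "P = p ^ n"
  define N where "N = (\<lambda>a. card {x \<in> Fq (2 * ?k). trace (2 * ?k) (poly F x) = a})"
  define B where "B = p * P\<^sup>2 + 2 * d * (p * P)"
  have NB: "N a \<le> B" for a
    unfolding N_def B_def by (rule stepanov_bound) (simp add: P_def)
  have fin: "finite (Fq (2 * ?k))" "finite (Fq 1)" by (simp_all add: card_Fq)
  have tr1: "trace (2 * ?k) (poly F x) \<in> Fq 1" if "x \<in> Fq (2 * ?k)" for x
    by (intro trace_in_Fq1 poly_F_in_Fq that)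
  have "char_sum (2 * ?k) = (\<Sum>a\<in>Fq 1. \<Sum>x\<in>{x \<in> Fq (2 * ?k). trace (2 * ?k) (poly F x) = a}. psi (trace (2 * ?k) (poly F x)))"
    unfolding char_sum_def by (rule sum.group[symmetric]) (use fin tr1 in auto)
  also have "\<dots> = (\<Sum>a\<in>Fq 1. of_nat (N a) * psi a)"
    by (simp add: N_def)
  also have "\<dots> = (\<Sum>a\<in>Fq 1. of_nat (N a) * psi a) - of_nat B * (\<Sum>a\<in>Fq 1. psi a)"
    by (simp only: sum_psi mult_zero_right diff_zero)
  also have "\<dots> = (\<Sum>a\<in>Fq 1. - (of_nat (B - N a) * psi a))"
    by (simp add: sum_distrib_left of_nat_diff NB algebra_simps flip: sum_subtractf del: One_nat_def)
  also have "norm \<dots> \<le> (\<Sum>a\<in>Fq 1. real (B - N a))"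
    by (rule order.trans[OF norm_sum]) (simp add: norm_mult)
  also have "\<dots> = (\<Sum>a\<in>Fq 1. real B) - real (\<Sum>a\<in>Fq 1. N a)"
    by (simp add: of_nat_diff NB sum_subtractf del: One_nat_def)
  also have "(\<Sum>a\<in>Fq 1. N a) = card (Fq (2 * ?k))"
    unfolding N_def using sum.group[OF fin, of "\<lambda>x. trace (2 * ?k) (poly F x)" "\<lambda>_. 1::nat"] tr1 by auto
  also have "card (Fq (2 * ?k)) = p ^ (2 * ?k)" by (simp add: card_Fq)
  also have "p ^ (2 * ?k) = p * (p * P\<^sup>2)" by (simp add: P_def power2_eq_square mult_2 power_add)
  also have "(\<Sum>a\<in>Fq 1. real B) = p * real B" by (simp add: card_Fq(2)[of 1, simplified])
  also have "p * real B - real (p * (p * P\<^sup>2)) = 2 * d * p * p ^ Suc n"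
    by (simp add: B_def P_def algebra_simps power2_eq_square)
  finally show ?thesis by simp
qed

lemma char_sum_1: "char_sum 1 = (\<Sum>j<p. cis (2 * pi * real_of_int (poly f (int j)) / real p))"
proof -
  have F: "poly F (of_nat j) = of_int (poly f (int j))" for j
    unfolding F_def by (metis of_int_hom.poly_map_poly of_int_of_nat_eq)
  have "char_sum 1 = (\<Sum>x\<in>Fq 1. psi (poly F x))"
    by (simp add: char_sum_def trace_def)
  also have "\<dots> = (\<Sum>j<p. psi (poly F (of_nat j)))"
    by (rule sum.reindex_bij_betw[OF bij_Fq1, symmetric])
  finally show ?thesis by (simp add: F psi_of_int)
qed

end

section \<open>Weil's bound\<close>

lemma Re_psum_ge:
  assumes "\<And>a. a \<in># Z \<Longrightarrow> Re (a ^ k) \<ge> 0" "z \<in># Z"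
  shows "Re (psum Z k) \<ge> Re (z ^ k)"
proof -
  obtain Y where Z: "Z = add_mset z Y" using assms(2) by (metis insert_DiffM)
  have "Re (psum Y k) \<ge> 0"
    using assms(1) unfolding Z by (induction Y) (auto simp: psum_def intro!: add_nonneg_nonneg)
  thus ?thesis by (simp add: psum_def Z)
qed

text \<open>By simultaneous Diophantine approximation of the arguments, infinitely many powers
  of all the members lie in the sector of half-angle \<open>\<pi>/3\<close> around the positive axis.\<close>
lemma norm_le_1_if_psum_bounded:
  fixes Z :: "complex multiset"
  assumes B: "\<And>k. k > 0 \<Longrightarrow> norm (psum Z k) \<le> B" and z: "z \<in># Z"
  shows "norm z \<le> 1"
proof (rule ccontr)
  assume "\<not> norm z \<le> 1"
  hence z1: "norm z > 1" by simp
  obtain K0 where K0: "2 * B < norm z ^ K0"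
    using real_arch_pow[OF z1] by blast
  obtain zs where zs: "mset zs = Z" using ex_mset by blast
  \<comment> \<open>The factor \<open>Suc K0\<close> makes the exponent \<open>k\<close> a positive
    multiple of \<open>Suc K0\<close>, hence large enough for the contradiction. The tolerance 1/6
    of a turn is \<open>pi / 3\<close>, where the cosine is 1/2.\<close>
  define \<theta> where "\<theta> = (\<lambda>i. real (Suc K0) * Arg (zs ! i) / (2 * pi))"
  obtain q m where q: "0 < q" "\<And>i. i < length zs \<Longrightarrow> \<bar>of_int q * \<theta> i - of_int (m i)\<bar> < 1 / real 6"
    using Dirichlet_approx_simult[of 6 "length zs" \<theta>] by (metis zero_less_numeral)
  define k where "k = Suc K0 * nat q"
  have "nat q \<ge> 1" using q(1) by simp
  from mult_le_mono2[OF this, of "Suc K0"] have k: "k \<ge> Suc K0" by (simp add: k_def)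
  have main: "Re (a ^ k) \<ge> norm a ^ k / 2" if "a \<in># Z" for a
  proof -
    have "a \<in> set zs" using that zs by auto
    then obtain i where i: "i < length zs" "a = zs ! i" by (auto simp: in_set_conv_nth)
    define x where "x = of_int q * \<theta> i - of_int (m i)"
    have x: "\<bar>x\<bar> < 1 / 6" using q(2)[OF i(1)] by (simp add: x_def)
    have eq: "real k * Arg a = 2 * pi * x + 2 * pi * of_int (m i)"
      using q(1) by (simp add: x_def \<theta>_def k_def i(2) field_simps)
    have "cis (Arg a) ^ k = cis (2 * pi * x) * cis (2 * pi * of_int (m i))"
      by (simp only: Complex.DeMoivre eq cis_mult)
    also have "\<dots> = cis (2 * pi * x)" by (simp add: cis_multiple_2pi)
    finally have "(of_real (norm a) * cis (Arg a)) ^ k = of_real (norm a ^ k) * cis (2 * pi * x)"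
      by (simp add: power_mult_distrib)
    hence "a ^ k = of_real (norm a ^ k) * cis (2 * pi * x)"
      by (simp add: rcis_cmod_Arg flip: rcis_def)
    hence "Re (a ^ k) = norm a ^ k * cos \<bar>2 * pi * x\<bar>" by simp
    moreover have "cos (pi / 3) \<le> cos \<bar>2 * pi * x\<bar>"
      using x by (intro cos_monotone_0_pi_le) (auto simp: abs_mult field_simps)
    hence "norm a ^ k * (1 / 2) \<le> norm a ^ k * cos \<bar>2 * pi * x\<bar>"
      by (intro mult_left_mono) (simp_all add: cos_60)
    ultimately show ?thesis by simp
  qed
  have "norm z ^ K0 / 2 \<le> norm z ^ k / 2"
    using z1 k by (intro divide_right_mono power_increasing) auto
  also have "\<dots> \<le> Re (z ^ k)" by (rule main[OF z])
  also have "\<dots> \<le> Re (psum Z k)"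
    using main by (intro Re_psum_ge[OF _ z]) (metis divide_nonneg_nonneg norm_ge_zero order.trans zero_le_numeral zero_le_power)
  also have "\<dots> \<le> B" using complex_Re_le_cmod B[of k] k by (metis Suc_le_lessD order.trans zero_less_Suc less_le_trans)
  finally show False using K0 by simp
qed

definition weil_bound :: "nat \<Rightarrow> bool" where
  "weil_bound p \<longleftrightarrow> (\<forall>f :: int poly. 0 < degree f \<longrightarrow> degree f < p \<longrightarrow> \<not> int p dvd lead_coeff f \<longrightarrow>
     norm (\<Sum>j<p. cis (2 * pi * real_of_int (poly f (int j)) / real p)) \<le> real (degree f - 1) * sqrt (real p))"

text \<open>The numbers \<open>w\<^sup>2 / p\<close> have bounded power sums by
  \<open>norm_char_sum_even\<close>, so each \<open>w\<close> has modulus at most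
  \<open>sqrt p\<close>; \<open>char_sum 1\<close> is minus the sum of \<open>d - 1\<close> of
  them.\<close>

lemma (in weil_sum) weil: "norm (char_sum 1) \<le> real (d - 1) * sqrt (real p)"
proof -
  obtain W where W: "size W = d - 1" "\<And>r. r > 0 \<Longrightarrow> char_sum r = - psum W r"
    using char_sum_eq_psum by blast
  define Z where "Z = image_mset (\<lambda>w. w\<^sup>2 / of_nat p) W"
  have psumZ: "psum Z k = psum W (2 * k) / of_nat p ^ k" for k
    unfolding Z_def psum_def 
    by (induction W) (simp_all add: power_divide add_divide_distrib power_mult)
  have bound: "norm (psum Z k) \<le> real (2 * d * p)" if k: "k > 0" for k
  proof -
    obtain n where n: "k = Suc n" using k by (cases k) auto
    have "norm (psum Z k) = norm (char_sum (2 * k)) / real p ^ k"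
      using k by (simp add: psumZ W norm_divide norm_power)
    also have "\<dots> \<le> real (2 * d * p * p ^ k) / real p ^ k"
      using norm_char_sum_even[of n] by (intro divide_right_mono) (simp_all add: n)
    also have "\<dots> = real (2 * d * p)" using p_gt_0 by simp
    finally show ?thesis .
  qed
  have w: "norm w \<le> sqrt p" if "w \<in># W" for w
  proof -
    have "norm (w\<^sup>2 / of_nat p) \<le> 1"
      using that by (intro norm_le_1_if_psum_bounded[OF bound]) (auto simp: Z_def)
    hence "(norm w)\<^sup>2 \<le> p" using p_gt_0 by (simp add: norm_divide norm_power)
    thus ?thesis by (rule real_le_rsqrt)
  qed
  have "norm (psum W 1) \<le> real (size W) * sqrt (real p)"
    using w
  proof (induction W)
    case (add a A)
    have "norm (psum (add_mset a A) 1) \<le> norm a + norm (psum A 1)"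
      by (simp add: psum_def norm_triangle_ineq)
    also have "\<dots> \<le> sqrt p + real (size A) * sqrt p"
      using add by (intro add_mono) auto
    finally show ?case by (simp add: algebra_simps)
  qed (simp add: psum_def)
  thus ?thesis using W by simp
qed

lemma (in prime_char) weil_bound_CHAR: "weil_bound p"
  unfolding weil_bound_def
proof (intro allI impI)
  fix f :: "int poly"
  assume f: "0 < degree f" "degree f < p" "\<not> int p dvd lead_coeff f"
  interpret weil_sum p K f "degree f"
    by unfold_locales (use f in auto)
  show "norm (\<Sum>j<p. cis (2 * pi * real_of_int (poly f (int j)) / real p)) \<le> real (degree f - 1) * sqrt (real p)"
    using weil by (simp only: char_sum_1)
qed

text \<open>HOL has no types depending on a variable \<open>p\<close>, hence no type of residues modulo an arbitrary \<open>p\<close>.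
  But a putative counterexample to the bound is given by a closed term, over which a type can be
  defined.\<close>
definition bad_prime :: nat where
  "bad_prime = (if \<exists>p. prime p \<and> \<not> weil_bound p then SOME p. prime p \<and> \<not> weil_bound p else 2)"

text \<open>The default value 2 makes this true without a counterexample, so the type below exists
  unconditionally.\<close>

lemma prime_bad_prime: "prime bad_prime"
  unfolding bad_prime_def by (auto intro: someI2_ex)

typedef bad_index = "{..<bad_prime}"
  using prime_gt_0_nat[OF prime_bad_prime] by auto

lemma card_bad_index: "CARD(bad_index) = bad_prime"
  using type_definition.card[OF type_definition_bad_index] by simp

instance bad_index :: prime_card
proof
  show "prime CARD(bad_index)" by (simp add: card_bad_index prime_bad_prime)
qed

instance alg_closure :: (field_prime_char) field_prime_char
  by (rule field_prime_charI') auto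

theorem weil_bound:
  assumes "prime p"
  shows "weil_bound p"
proof (rule ccontr)
  assume "\<not> weil_bound p"
  hence ex: "\<exists>p. prime p \<and> \<not> weil_bound p" using assms by blast
  hence "\<not> weil_bound bad_prime"
    using someI_ex[OF ex] by (simp add: bad_prime_def)
  \<comment> \<open>The algebraic closure of the field with \<open>bad_prime\<close> elements
    interprets the locale.\<close>
  moreover have "prime_char TYPE(bad_index mod_ring alg_closure) bad_prime"
    by unfold_locales (simp add: card_bad_index)
  hence "weil_bound bad_prime" by (rule prime_char.weil_bound_CHAR)
  ultimately show False by contradiction
qed

section \<open>Coherence and sparse recovery\<close>

lemma norm2_le_norm1: "norm2 v I \<le> norm1 v I"
  using L2_set_le_sum[of I "\<lambda>i. cmod (v i)"] by (simp add: norm2_def norm1_def L2_set_def)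

text \<open>A flat error has less than half of its l1 mass on any \<open>s\<close> indices, while
  minimality of \<open>y\<close> prevents the mass elsewhere from exceeding that by more than twice
  the tail of \<open>x\<close>. The infimum is treated by bounding every competitor
  \<open>z\<close>.\<close>

lemma l1_recovery:
  fixes x y :: "'i \<Rightarrow> complex"
  assumes I: "finite I"
    and flat: "\<And>i. i \<in> I \<Longrightarrow> cmod (y i - x i) \<le> \<kappa> * norm1 (\<lambda>i. y i - x i) I"
    and \<kappa>: "0 \<le> \<kappa>" "2 * real s * \<kappa> < 1"
    and le: "norm1 y I \<le> norm1 x I"
  shows "norm1 (\<lambda>i. y i - x i) I \<le> 2 / (1 - 2 * real s * \<kappa>) * sigma_s1 s x I"
proof -
  define v where "v = (\<lambda>i. y i - x i)"
  have "(1 - 2 * real s * \<kappa>) / 2 * norm1 v I \<le> sigma_s1 s x I"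
    unfolding sigma_s1_def
  proof (rule cInf_greatest)
    show "{norm1 (\<lambda>i. x i - z i) I | z. card {i \<in> I. z i \<noteq> 0} \<le> s} \<noteq> {}"
      by (auto intro: exI[of _ "\<lambda>_. 0"])
  next
    fix t assume "t \<in> {norm1 (\<lambda>i. x i - z i) I | z. card {i \<in> I. z i \<noteq> 0} \<le> s}"
    then obtain z where z: "t = norm1 (\<lambda>i. x i - z i) I" "card {i \<in> I. z i \<noteq> 0} \<le> s" by auto
    define T where "T = {i \<in> I. z i \<noteq> 0}"
    have T: "finite T" "T \<subseteq> I" using I by (auto simp: T_def)
    have split: "norm1 w I = norm1 w T + norm1 w (I - T)" for w :: "'i \<Rightarrow> complex"
      unfolding norm1_def using sum.subset_diff[OF T(2) I] by (simp add: add.commute)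
    have vT: "norm1 v T \<le> real s * \<kappa> * norm1 v I"
    proof -
      have "norm1 v T \<le> real (card T) * (\<kappa> * norm1 v I)"
        unfolding norm1_def[of v T] using flat T(2) by (intro sum_bounded_above) (auto simp: v_def)
      also have "\<dots> \<le> real s * (\<kappa> * norm1 v I)"
        using z(2) \<kappa>(1) by (intro mult_right_mono) (auto simp: T_def norm1_def intro!: mult_nonneg_nonneg sum_nonneg)
      finally show ?thesis by simp
    qed
    have tail: "norm1 x (I - T) \<le> t"
    proof -
      have "norm1 x (I - T) = norm1 (\<lambda>i. x i - z i) (I - T)"
        unfolding norm1_def by (intro sum.cong) (auto simp: T_def)
      also have "\<dots> \<le> t" unfolding z(1) norm1_def using I by (intro sum_mono2) auto
      finally show ?thesis .
    qed
    have pw: "cmod (x i) - cmod (v i) \<le> cmod (y i)" "cmod (v i) - cmod (x i) \<le> cmod (y i)" for i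
      using norm_triangle_ineq2[of "x i" "x i - y i"] norm_triangle_ineq4[of "y i" "x i"]
      by (simp_all add: v_def norm_minus_commute)
    have "norm1 y T \<ge> norm1 x T - norm1 v T"
      unfolding norm1_def sum_subtractf[symmetric]
      by (intro sum_mono pw)
    moreover have "norm1 y (I - T) \<ge> norm1 v (I - T) - norm1 x (I - T)"
      unfolding norm1_def sum_subtractf[symmetric]
      by (intro sum_mono pw)
    ultimately have "norm1 v I \<le> 2 * norm1 v T + 2 * t"
      using tail le split[of v] split[of x] split[of y] by linarith
    with vT show "(1 - 2 * real s * \<kappa>) / 2 * norm1 v I \<le> t" by (simp add: field_simps)
  qed
  thus ?thesis using \<kappa>(2) by (simp add: v_def field_simps)
qed

text \<open>Pairing the kernel equation with column \<open>i\<close> isolates \<open>v i\<close>,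
  giving \<open>cmod (v i) \<le> \<mu> * (norm1 v I - cmod (v i))\<close>.\<close>

lemma flat_kernel:
  fixes A :: "nat \<Rightarrow> 'i \<Rightarrow> real" and v :: "'i \<Rightarrow> complex"
  assumes I: "finite I" "i \<in> I"
    and unit: "(\<Sum>j<m. (A j i)\<^sup>2) = 1"
    and coh: "\<And>k. k \<in> I \<Longrightarrow> k \<noteq> i \<Longrightarrow> \<bar>\<Sum>j<m. A j i * A j k\<bar> \<le> \<mu>"
    and ker: "\<And>j. j < m \<Longrightarrow> (\<Sum>k\<in>I. of_real (A j k) * v k) = 0"
    and "\<mu> \<ge> 0"
  shows "cmod (v i) \<le> \<mu> / (1 + \<mu>) * norm1 v I"
proof -
  define g where "g = (\<lambda>k. \<Sum>j<m. A j i * A j k)"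
  have "0 = (\<Sum>j<m. of_real (A j i) * (\<Sum>k\<in>I. of_real (A j k) * v k))"
    by (simp add: ker)
  also have "\<dots> = (\<Sum>k\<in>I. of_real (g k) * v k)"
    unfolding sum_distrib_left g_def of_real_sum sum_distrib_right
    by (subst sum.swap) (simp add: mult.assoc)
  also have "\<dots> = v i + (\<Sum>k\<in>I-{i}. of_real (g k) * v k)"
    using unit by (subst sum.remove[OF I]) (simp add: g_def power2_eq_square)
  finally have "v i = - (\<Sum>k\<in>I-{i}. of_real (g k) * v k)" by (simp add: eq_neg_iff_add_eq_0)
  hence "cmod (v i) = cmod (\<Sum>k\<in>I-{i}. of_real (g k) * v k)" by (simp only: norm_minus_cancel)
  also have "\<dots> \<le> (\<Sum>k\<in>I-{i}. cmod (of_real (g k) * v k))" by (rule norm_sum)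
  also have "\<dots> \<le> (\<Sum>k\<in>I-{i}. \<mu> * cmod (v k))"
    unfolding norm_mult norm_of_real
    by (intro sum_mono mult_right_mono) (use coh in \<open>auto simp: g_def\<close>)
  also have "\<dots> = \<mu> * (norm1 v I - cmod (v i))"
    using sum.remove[OF I, of "\<lambda>k. cmod (v k)"] by (simp add: norm1_def sum_distrib_left)
  finally show ?thesis using \<open>\<mu> \<ge> 0\<close> by (simp add: field_simps)
qed

section \<open>Reflection symmetry of the samples\<close>

lemma cos_mult_arccos_cos: "cos (real n * arccos (cos x)) = cos (real n * x)"
proof -
  have cheb: "cos (real (Suc (Suc n)) * z) = 2 * cos z * cos (real (Suc n) * z) - cos (real n * z)" for z :: real and n
  proof -
    have "real (Suc (Suc n)) * z = real (Suc n) * z + z" "real n * z = real (Suc n) * z - z"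
      by (simp_all add: algebra_simps)
    moreover have "cos (a + z) = 2 * cos z * cos a - cos (a - z)" for a
      by (simp add: cos_add cos_diff)
    ultimately show ?thesis by (simp only:)
  qed
  \<comment> \<open>\<open>arccos (cos x)\<close> may differ from \<open>x\<close>, but by the
    Chebyshev recurrence \<open>cos (n y)\<close> depends on \<open>cos y\<close> alone.\<close>
  have eq: "cos (real n * y) = cos (real n * x)" if "cos y = cos x" for y
  proof (induction n rule: induct_nat_012)
    case (ge2 n)
    thus ?case by (simp only: cheb that)
  qed (use that in simp_all)
  show ?thesis by (rule eq, rule cos_arccos) simp_all
qed

lemma AP_eq: "AP M d j n = (\<Prod>t<d. cos (real (n t) * (2 * pi * real (j ^ (t + 1)) / real M)))"
  unfolding AP_def Phi_def samplept_def by (intro prod.cong refl) (simp add: cos_mult_arccos_cos)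

lemma AP_0: "AP M d 0 n = 1"
  by (simp add: AP_eq)

text \<open>Powers of \<open>M - j\<close> and \<open>- j\<close> agree modulo \<open>M\<close>, and
  the cosine is even and periodic.\<close>

lemma AP_reflect:
  assumes "0 < M" "j \<le> M"
  shows "AP M d (M - j) n = AP M d j n"
  unfolding AP_eq
proof (intro prod.cong refl)
  fix t
  have gen: "A = B + real M * z \<Longrightarrow> c * (2 * pi * A / real M) = c * (2 * pi * B / real M) + 2 * pi * (c * z)"
    for A B c z using assms by (simp add: field_simps)
  have "(int M - int j) ^ (t + 1) mod int M = (- int j) ^ (t + 1) mod int M"
    using power_mod[of "int M - int j" "int M" "t + 1"] power_mod[of "- int j" "int M" "t + 1"]
      mod_add_self1[of "int M" "- int j"] by simp
  then obtain z where z: "(int M - int j) ^ (t + 1) = (- int j) ^ (t + 1) + int M * z"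
    by (metis mod_eqE mult.commute)
  have "real ((M - j) ^ (t + 1)) = of_int ((int M - int j) ^ (t + 1))"
    using assms by (simp add: of_nat_diff)
  also have "\<dots> = (- real j) ^ (t + 1) + real M * of_int z" unfolding z by simp
  finally have "real (n t) * (2 * pi * real ((M - j) ^ (t + 1)) / real M) =
      real (n t) * (2 * pi * (- real j) ^ (t + 1) / real M) + 2 * pi * of_int (int (n t) * z)"
    unfolding of_int_mult of_int_of_nat_eq by (rule gen)
  hence "cos (real (n t) * (2 * pi * real ((M - j) ^ (t + 1)) / real M)) = 
     cos (real (n t) * (2 * pi * (- real j) ^ (t + 1) / real M))"
    by (simp only: cos_add cos_int_2pin sin_int_2pin mult_1_right mult_zero_right diff_zero)
  also have "\<dots> = cos (real (n t) * (2 * pi * real (j ^ (t + 1)) / real M))"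
    by (cases "even (t + 1)") (simp_all add: power_minus_odd)
  finally show "cos (real (n t) * (2 * pi * real ((M - j) ^ (t + 1)) / real M)) = \<dots>" .
qed

text \<open>Reflection pairs off the nonzero indices; index 0 is counted once in the full sum, with
  value 1, which explains the extra 1.\<close>

lemma sum_half_AP:
  assumes "odd M"
  shows "2 * (\<Sum>j<nsamples M. AP M d j n * AP M d j k) = (\<Sum>j<M. AP M d j n * AP M d j k) + 1"
proof -
  obtain h where h: "M = 2 * h + 1" using assms by (elim oddE)
  define g where "g = (\<lambda>j. AP M d j n * AP M d j k)"
  have "(\<Sum>j<M. g j) = (\<Sum>j\<in>{..h}. g j) + (\<Sum>j\<in>{h+1..2*h}. g j)"
  proof -
    have "{..<M} = {..h} \<union> {h+1..2*h}" by (auto simp: h)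
    thus ?thesis by (simp only:) (rule sum.union_disjoint; auto)
  qed
  also have "(\<Sum>j\<in>{h+1..2*h}. g j) = (\<Sum>j\<in>{1..h}. g j)"
  proof (rule sum.reindex_bij_witness[of _ "\<lambda>j. M - j" "\<lambda>j. M - j"])
    fix j assume "j \<in> {h+1..2*h}"
    hence "0 < M" "j \<le> M" by (auto simp: h)
    thus "g (M - j) = g j" by (simp only: g_def AP_reflect)
  qed (auto simp: h)
  also have "(\<Sum>j\<in>{1..h}. g j) = (\<Sum>j\<in>{..h}. g j) - g 0"
    by (simp add: sum.atLeast_Suc_atMost[of 0] atMost_atLeast0)
  also have "{..h} = {..<nsamples M}" by (auto simp: nsamples_def h)
  finally show ?thesis by (simp add: g_def AP_0)
qed

section \<open>Column inner products as exponential sums\<close>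

lemma cis_sum: "cis (\<Sum>t\<in>B. x t) = (\<Prod>t\<in>B. cis (x t))"
  by (induction B rule: infinite_finite_induct) (simp_all flip: cis_mult)

definition sgn_if :: "bool \<Rightarrow> int" where "sgn_if b = (if b then 1 else - 1)"

text \<open>Each cosine is the mean of two conjugate exponentials; \<open>B\<close> records the
  factors where the positive sign is taken.\<close>

lemma prod_cos_eq_sum_cis:
  "(\<Prod>t<d. of_real (cos (x t))) = 
   (\<Sum>B\<in>Pow {..<d}. cis (\<Sum>t<d. of_int (sgn_if (t \<in> B)) * x t)) / 2 ^ d"
proof -
  have "(\<Prod>t<d. of_real (cos (x t))) = (\<Prod>t<d. cis (x t) + cis (- x t)) / (2 :: complex) ^ d"
    by (simp add: cis_conv_exp cos_exp_eq prod_dividef flip: cos_of_real)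
  also have "(\<Prod>t<d. cis (x t) + cis (- x t)) = 
      (\<Sum>B\<in>Pow {..<d}. (\<Prod>t\<in>B. cis (x t)) * (\<Prod>t\<in>{..<d}-B. cis (- x t)))"
    by (rule prod_add) simp
  also have "\<dots> = (\<Sum>B\<in>Pow {..<d}. cis (\<Sum>t<d. of_int (sgn_if (t \<in> B)) * x t))"
  proof (intro sum.cong refl)
    fix B assume B: "B \<in> Pow {..<d}"
    have "(\<Sum>t<d. of_int (sgn_if (t \<in> B)) * x t) = (\<Sum>t\<in>B. x t) + (\<Sum>t\<in>{..<d}-B. - x t)"
      using B by (subst sum.subset_diff[of B]) (auto simp: sgn_if_def sum_negf add.commute intro!: sum.cong)
    thus "(\<Prod>t\<in>B. cis (x t)) * (\<Prod>t\<in>{..<d}-B. cis (- x t)) = cis (\<Sum>t<d. of_int (sgn_if (t \<in> B)) * x t)"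
      by (simp add: cis_sum flip: cis_mult)
  qed
  finally show ?thesis .
qed

definition expsum :: "nat \<Rightarrow> nat \<Rightarrow> (nat \<Rightarrow> int) \<Rightarrow> complex" where
  "expsum M d a = (\<Sum>j<M. cis (2 * pi * of_int (\<Sum>t<d. a t * int j ^ (t + 1)) / real M))"

text \<open>A nonzero coefficient smaller than \<open>M\<close> in absolute value is not divisible
  by \<open>M\<close>, so the degree survives reduction modulo \<open>M\<close> and
  \<open>weil_bound\<close> applies.\<close>

lemma norm_expsum_le:
  assumes M: "prime M" "d < M" and a: "\<And>t. t < d \<Longrightarrow> \<bar>a t\<bar> < int M" and nz: "t0 < d" "a t0 \<noteq> 0"
  shows "norm (expsum M d a) \<le> real (d - 1) * sqrt (real M)"
proof -
  define f where "f = (\<Sum>t<d. monom (a t) (t + 1))"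
  have cf: "coeff f i = (if 0 < i \<and> i \<le> d then a (i - 1) else 0)" for i
    by (cases i) (auto simp: f_def coeff_sum coeff_monom)
  have deg: "degree f \<le> d" by (rule degree_le) (auto simp: cf)
  have "degree f \<ge> t0 + 1" by (rule le_degree) (use nz in \<open>simp add: cf\<close>)
  hence deg0: "degree f > 0" by simp
  hence "lead_coeff f \<noteq> 0" by auto
  moreover have "\<bar>lead_coeff f\<bar> < int M" unfolding cf using a deg deg0 by auto
  ultimately have "\<not> int M dvd lead_coeff f" by (metis abs_of_nat dvd_imp_le_int linorder_not_less)
  hence "norm (\<Sum>j<M. cis (2 * pi * real_of_int (poly f (int j)) / real M)) \<le> real (degree f - 1) * sqrt (real M)"
    using weil_bound[OF M(1)] deg deg0 M(2) unfolding weil_bound_def by auto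
  also have "\<dots> \<le> real (d - 1) * sqrt (real M)"
    using deg by (intro mult_right_mono) auto
  finally show ?thesis
    by (simp add: expsum_def f_def poly_sum poly_monom)
qed

definition sgn_comb :: "(nat \<Rightarrow> nat) \<Rightarrow> (nat \<Rightarrow> nat) \<Rightarrow> nat set \<Rightarrow> nat set \<Rightarrow> nat \<Rightarrow> int" where
  "sgn_comb n k B B' t = sgn_if (t \<in> B) * int (n t) + sgn_if (t \<in> B') * int (k t)"

lemma sum_AP_eq_expsum:
  "of_real (\<Sum>j<M. AP M d j n * AP M d j k) = 
   (\<Sum>B\<in>Pow {..<d}. \<Sum>B'\<in>Pow {..<d}. expsum M d (sgn_comb n k B B')) / 4 ^ d"
proof -
  define x where "x = (\<lambda>j n t. real (n t) * (2 * pi * real (j ^ (t + 1)) / real M))"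
  have four: "(2 :: complex) ^ d * 2 ^ d = 4 ^ d" by (simp flip: power_mult_distrib)
  have "of_real (\<Sum>j<M. AP M d j n * AP M d j k) = 
      (\<Sum>j<M. (\<Prod>t<d. of_real (cos (x j n t))) * (\<Prod>t<d. of_real (cos (x j k t))) :: complex)"
    by (simp add: AP_eq x_def)
  also have "\<dots> = (\<Sum>j<M. (\<Sum>B\<in>Pow {..<d}. \<Sum>B'\<in>Pow {..<d}.
      cis (\<Sum>t<d. of_int (sgn_if (t \<in> B)) * x j n t) * cis (\<Sum>t<d. of_int (sgn_if (t \<in> B')) * x j k t))) / 4 ^ d"
    by (simp add: prod_cos_eq_sum_cis sum_product sum_divide_distrib four)
  also have "(\<Sum>j<M. (\<Sum>B\<in>Pow {..<d}. \<Sum>B'\<in>Pow {..<d}.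
      cis (\<Sum>t<d. of_int (sgn_if (t \<in> B)) * x j n t) * cis (\<Sum>t<d. of_int (sgn_if (t \<in> B')) * x j k t)))
    = (\<Sum>j<M. (\<Sum>B\<in>Pow {..<d}. \<Sum>B'\<in>Pow {..<d}.
      cis (2 * pi * of_int (\<Sum>t<d. sgn_comb n k B B' t * int j ^ (t + 1)) / real M)))"
  proof (intro sum.cong refl)
    fix j B B'
    have "(\<Sum>t<d. of_int (sgn_if (t \<in> B)) * x j n t) + (\<Sum>t<d. of_int (sgn_if (t \<in> B')) * x j k t)
       = 2 * pi * of_int (\<Sum>t<d. sgn_comb n k B B' t * int j ^ (t + 1)) / real M"
      by (simp add: sum.distrib[symmetric] sgn_comb_def x_def sum_distrib_left sum_divide_distrib algebra_simps add_divide_distrib)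
    thus "cis (\<Sum>t<d. of_int (sgn_if (t \<in> B)) * x j n t) * cis (\<Sum>t<d. of_int (sgn_if (t \<in> B')) * x j k t)
       = cis (2 * pi * of_int (\<Sum>t<d. sgn_comb n k B B' t * int j ^ (t + 1)) / real M)"
      by (simp only: cis_mult)
  qed
  also have "\<dots> = (\<Sum>B\<in>Pow {..<d}. \<Sum>j<M. \<Sum>B'\<in>Pow {..<d}.
      cis (2 * pi * of_int (\<Sum>t<d. sgn_comb n k B B' t * int j ^ (t + 1)) / real M))"
    by (rule sum.swap)
  also have "\<dots> = (\<Sum>B\<in>Pow {..<d}. \<Sum>B'\<in>Pow {..<d}. expsum M d (sgn_comb n k B B'))"
    unfolding expsum_def by (rule sum.cong[OF refl], rule sum.swap)
  finally show ?thesis .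
qed

lemma LambdaP_neq: "n \<in> LambdaP q d \<Longrightarrow> k \<in> LambdaP q d \<Longrightarrow> n \<noteq> k \<Longrightarrow> \<exists>t<d. n t \<noteq> k t"
proof (rule ccontr)
  assume *: "n \<in> LambdaP q d" "k \<in> LambdaP q d" "n \<noteq> k" "\<not> (\<exists>t<d. n t \<noteq> k t)"
  have "n t = k t" for t using * by (cases "t < d") (auto simp: LambdaP_def)
  with \<open>n \<noteq> k\<close> show False by blast
qed

lemma finite_LambdaP: "finite (LambdaP q d)"
proof (rule finite_subset)
  show "LambdaP q d \<subseteq> (\<lambda>xs t. if t < d then xs ! t else 0) ` {xs. set xs \<subseteq> {..q} \<and> length xs = d}"
  proof
    fix n assume n: "n \<in> LambdaP q d"
    show "n \<in> (\<lambda>xs t. if t < d then xs ! t else 0) ` {xs. set xs \<subseteq> {..q} \<and> length xs = d}"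
      by (rule image_eqI[of _ _ "map n [0..<d]"]) (use n in \<open>auto simp: LambdaP_def\<close>)
  qed
qed (intro finite_imageI finite_lists_length_eq finite_atMost)

text \<open>Here \<open>M \<ge> 2 * q + 1\<close> enters: the combinations have absolute value at
  most \<open>2 * q\<close>.\<close>

lemma sgn_comb_less:
  assumes "n \<in> LambdaP q d" "k \<in> LambdaP q d" "2 * q < M" "t < d"
  shows "\<bar>sgn_comb n k B B' t\<bar> < int M"
  using assms by (force simp: sgn_comb_def sgn_if_def LambdaP_def)

text \<open>Where \<open>n t\<close> and \<open>k t\<close> differ, being nonnegative, no choice of
  signs cancels them. So all \<open>4 ^ d\<close> exponential sums obey the Weil estimate.\<close>

lemma sum_AP_offdiag:
  assumes M: "prime M" "d < M" "2 * q < M"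
    and nk: "n \<in> LambdaP q d" "k \<in> LambdaP q d" "n \<noteq> k"
  shows "\<bar>\<Sum>j<M. AP M d j n * AP M d j k\<bar> \<le> real (d - 1) * sqrt (real M)"
proof -
  define b where "b = real (d - 1) * sqrt (real M)"
  obtain t where t: "t < d" "n t \<noteq> k t" using LambdaP_neq[OF nk] by blast
  have le: "norm (expsum M d (sgn_comb n k B B')) \<le> b" for B B'
    unfolding b_def using t
    by (intro norm_expsum_le[OF M(1,2) _ t(1)] sgn_comb_less[OF nk(1,2) M(3)]) (auto simp: sgn_comb_def sgn_if_def)
  have "norm (of_real (\<Sum>j<M. AP M d j n * AP M d j k) :: complex) \<le> 
      (\<Sum>B\<in>Pow {..<d}. \<Sum>B'\<in>Pow {..<d}. b) / 4 ^ d"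
    unfolding sum_AP_eq_expsum norm_divide norm_power norm_numeral
    by (intro divide_right_mono sum_norm_le le) simp
  also have "\<dots> = (2 ^ d * 2 ^ d) * b / 4 ^ d" by (simp add: card_Pow)
  also have "(2 :: real) ^ d * 2 ^ d = 4 ^ d" by (simp flip: power_mult_distrib)
  also have "4 ^ d * b / 4 ^ d = b" by simp
  finally show ?thesis unfolding b_def norm_of_real .
qed

text \<open>For each \<open>B\<close> the complementary choice of signs cancels every frequency and
  contributes \<open>M\<close>. Any other pair contributes either \<open>M\<close> or a sum under
  the Weil estimate, hence real part at least \<open>- b\<close>.\<close>

lemma sum_AP_diag:
  assumes M: "prime M" "d < M" "2 * q < M" and n: "n \<in> LambdaP q d"
  shows "(\<Sum>j<M. AP M d j n * AP M d j n) \<ge> real M / 2 ^ d - real (d - 1) * sqrt (real M)"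
proof -
  define b where "b = real (d - 1) * sqrt (real M)"
  have b: "b \<ge> 0" by (simp add: b_def)
  have ge: "Re (expsum M d (sgn_comb n n B B')) \<ge> - b" for B B'
  proof (cases "\<forall>t<d. sgn_comb n n B B' t = 0")
    case True
    hence "expsum M d (sgn_comb n n B B') = of_nat M" by (simp add: expsum_def)
    thus ?thesis using b by simp
  next
    case False
    then obtain t where t: "t < d" "sgn_comb n n B B' t \<noteq> 0" by blast
    have "norm (expsum M d (sgn_comb n n B B')) \<le> b"
      unfolding b_def using t
      by (intro norm_expsum_le[OF M(1,2), of _ t] sgn_comb_less[OF n n M(3)])
    thus ?thesis using abs_Re_le_cmod[of "expsum M d (sgn_comb n n B B')"] by linarith
  qed
  have compl: "Re (expsum M d (sgn_comb n n B ({..<d} - B))) = real M" for B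
  proof -
    have "(\<Sum>t<d. sgn_comb n n B ({..<d} - B) t * int j ^ (t + 1)) = 0" for j
      by (intro sum.neutral) (auto simp: sgn_comb_def sgn_if_def)
    thus ?thesis by (simp add: expsum_def)
  qed
  have inner: "(\<Sum>B'\<in>Pow {..<d}. Re (expsum M d (sgn_comb n n B B'))) \<ge> real M - 2 ^ d * b" for B
  proof -
    have "(\<Sum>B'\<in>Pow {..<d}. Re (expsum M d (sgn_comb n n B B'))) = real M +
        (\<Sum>B'\<in>Pow {..<d} - {{..<d} - B}. Re (expsum M d (sgn_comb n n B B')))"
      by (subst sum.remove[of _ "{..<d} - B"]) (auto simp: compl)
    moreover have "(\<Sum>B'\<in>Pow {..<d} - {{..<d} - B}. - b) \<le>
        (\<Sum>B'\<in>Pow {..<d} - {{..<d} - B}. Re (expsum M d (sgn_comb n n B B')))"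
      by (intro sum_mono ge)
    moreover have "(\<Sum>B'\<in>Pow {..<d}. - b) \<le> (\<Sum>B'\<in>Pow {..<d} - {{..<d} - B}. - b)"
      using sum_mono2[of "Pow {..<d}" "Pow {..<d} - {{..<d} - B}" "\<lambda>_. b"] b by (simp add: sum_negf del: sum_constant)
    moreover have "(\<Sum>B'\<in>Pow {..<d}. - b) = - (2 ^ d * b)" by (simp add: card_Pow)
    ultimately show ?thesis by linarith
  qed
  have "(\<Sum>j<M. AP M d j n * AP M d j n) = Re (of_real (\<Sum>j<M. AP M d j n * AP M d j n))" by simp
  also have "\<dots> = (\<Sum>B\<in>Pow {..<d}. \<Sum>B'\<in>Pow {..<d}. Re (expsum M d (sgn_comb n n B B'))) / 4 ^ d"
    unfolding sum_AP_eq_expsum using Re_divide_of_real[of _ "4 ^ d"] by simp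
  finally have eq: "(\<Sum>j<M. AP M d j n * AP M d j n) =
    (\<Sum>B\<in>Pow {..<d}. \<Sum>B'\<in>Pow {..<d}. Re (expsum M d (sgn_comb n n B B'))) / 4 ^ d" .
  have four: "(4 :: real) ^ d = 2 ^ d * 2 ^ d" by (simp flip: power_mult_distrib)
  have "real M / 2 ^ d - b = (\<Sum>B\<in>Pow {..<d}. real M - 2 ^ d * b) / 4 ^ d"
    by (simp add: card_Pow four field_simps)
  also have "\<dots> \<le> (\<Sum>j<M. AP M d j n * AP M d j n)"
    unfolding eq by (intro divide_right_mono sum_mono inner) simp
  finally show ?thesis by (simp add: b_def)
qed

theorem theorem3:
  fixes d q s M :: nat
  assumes "d > 0" and "q > 0" and "s > 0"
    and "prime M"
    and "M \<ge> max (2 * q + 1) (9 * 4 ^ d * d\<^sup>2 * s\<^sup>2)"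
  shows "\<exists>K>0. \<forall>(c :: (nat \<Rightarrow> nat) \<Rightarrow> complex) (csharp :: (nat \<Rightarrow> nat) \<Rightarrow> complex).
    (let \<Lambda> = LambdaP q d;
         A = Amat M d;
         b = (\<lambda>j. \<Sum>n\<in>\<Lambda>. c n * complex_of_real (AP M d j n));
         ctilde = (\<lambda>n. c n / complex_of_real (Cdiag M d n))
     in ((\<forall>j<nsamples M. (\<Sum>n\<in>\<Lambda>. A j n * csharp n) = b j)
         \<and> (\<forall>z. (\<forall>j<nsamples M. (\<Sum>n\<in>\<Lambda>. A j n * z n) = b j) \<longrightarrow> norm1 csharp \<Lambda> \<le> norm1 z \<Lambda>))
        \<longrightarrow> norm2 (\<lambda>n. csharp n - ctilde n) \<Lambda> \<le> K * sigma_s1 s ctilde \<Lambda> / sqrt (real s))"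
proof -
  define r where "r = sqrt (real M)"
  \<comment> \<open>\<open>u / 2\<close> and \<open>l / 2\<close> will bound the off-diagonal and
    diagonal Gram entries; the 1 comes from \<open>sum_half_AP\<close>. Hence \<mu> bounds the
    coherence.\<close>
  define u where "u = real (d - 1) * r + 1"
  define l where "l = real M / 2 ^ d - real (d - 1) * r + 1"
  define \<mu> where "\<mu> = u / l"
  have M: "2 * q < M" "9 * 4 ^ d * d\<^sup>2 * s\<^sup>2 \<le> M" using assms(5) by auto
  have "odd M" using assms(2,4) M(1) prime_odd_nat by auto
  have r1: "r \<ge> 1" using assms(4) prime_gt_0_nat[of M] by (simp add: r_def)
  have rM: "r * r = real M" by (simp add: r_def)
  have r_ge: "3 * 2 ^ d * real d * real s \<le> r"
  proof -
    have "(3 * 2 ^ d * real d * real s)\<^sup>2 = real (9 * 4 ^ d * d\<^sup>2 * s\<^sup>2)"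
      by (simp add: power2_eq_square flip: power_mult_distrib)
    also have "\<dots> \<le> real M" using M(2) by (simp only: of_nat_le_iff)
    finally show ?thesis unfolding r_def by (rule real_le_rsqrt)
  qed
  have dM: "d < M"
  proof -
    have "d < 2 ^ d" by (rule less_exp)
    also have "2 ^ d \<le> (9 * 4 ^ d * d\<^sup>2 * s\<^sup>2 :: nat)"
    proof -
      have "(2::nat) ^ d \<le> 4 ^ d" by (rule power_mono) auto
      also have "\<dots> * 1 \<le> 4 ^ d * (9 * d\<^sup>2 * s\<^sup>2)"
        using assms(1,3) by (intro mult_le_mono2) auto
      finally show ?thesis by (simp add: mult_ac)
    qed
    finally show ?thesis using M(2) by simp
  qed
  have u0: "u > 0" using r1 by (simp add: u_def add_nonneg_pos)
  \<comment> \<open>By \<open>r_ge\<close>, \<open>M / 2 ^ d\<close> is at least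
    \<open>3 d s r\<close>. The left side plus \<open>(d - 1) r\<close> is
    \<open>2 s (d - 1) r + 2 s - 1\<close>, which is below \<open>2 d s r\<close> since
    \<open>r \<ge> 1\<close>.\<close>
  have ul: "(2 * real s - 1) * u < l"
  proof -
    have "3 * real d * real s * r \<le> real M / 2 ^ d"
    proof -
      have "3 * 2 ^ d * real d * real s * r \<le> r * r" using r_ge r1 by (intro mult_right_mono) auto
      thus ?thesis by (simp add: rM field_simps)
    qed
    moreover have d1: "real (d - 1) = real d - 1" using assms(1) by (simp add: of_nat_diff)
    moreover have "(2 * real s - 1) * ((real d - 1) * r + 1) < 3 * real d * real s * r - (real d - 1) * r + 1"
    proof -
      have "2 * real s * 1 \<le> 2 * real s * r" using r1 by (intro mult_left_mono) auto
      moreover have "real d * real s * r > 0" using assms r1 by simp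
      ultimately show ?thesis by (simp add: algebra_simps)
    qed
    ultimately show ?thesis unfolding u_def l_def d1 by linarith
  qed
  have "1 * u \<le> (2 * real s - 1) * u" using assms(3) u0 by (intro mult_right_mono) auto
  hence l0: "l > 0" using ul u0 by linarith
  have \<mu>0: "\<mu> > 0" and \<mu>s: "(2 * real s - 1) * \<mu> < 1"
    using u0 l0 ul by (simp_all add: \<mu>_def field_simps)
  \<comment> \<open>The flatness constant of \<open>flat_kernel\<close>;
    \<open>2 s \<kappa> < 1\<close> is equivalent to \<open>(2 s - 1) \<mu> < 1\<close>.\<close>
  define \<kappa> where "\<kappa> = \<mu> / (1 + \<mu>)"
  have \<kappa>: "\<kappa> \<ge> 0" "2 * real s * \<kappa> < 1"
    using \<mu>0 \<mu>s by (simp_all add: \<kappa>_def field_simps)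
  define g where "g = (\<lambda>n k. \<Sum>j<nsamples M. AP M d j n * AP M d j k)"
  have diag: "g n n \<ge> l / 2" if "n \<in> LambdaP q d" for n
    using sum_AP_diag[OF assms(4) dM M(1) that] sum_half_AP[OF \<open>odd M\<close>, of d n n]
    by (simp add: g_def l_def r_def)
  have offdiag: "\<bar>g n k\<bar> \<le> u / 2" if "n \<in> LambdaP q d" "k \<in> LambdaP q d" "n \<noteq> k" for n k
  proof -
    have half: "\<bar>a\<bar> \<le> (e + 1) / 2" if "\<bar>b\<bar> \<le> e" "2 * a = b + 1" for a b e :: real
      using that by (auto simp: abs_le_iff)
    show ?thesis
      unfolding g_def u_def r_def
      by (rule half[OF sum_AP_offdiag[OF assms(4) dM M(1) that] sum_half_AP[OF \<open>odd M\<close>]])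
  qed
  have Cd: "Cdiag M d n = 1 / sqrt (g n n)" for n
    by (simp add: Cdiag_def g_def power2_eq_square)
  have C0: "Cdiag M d n > 0" if "n \<in> LambdaP q d" for n
    using diag[OF that] l0 by (simp add: Cd)
  define B where "B = (\<lambda>j n. AP M d j n * Cdiag M d n)"
  have gram: "(\<Sum>j<nsamples M. B j n * B j k) = g n k * (Cdiag M d n * Cdiag M d k)" for n k
    by (simp add: B_def g_def sum_distrib_left mult_ac)
  have unit: "(\<Sum>j<nsamples M. (B j n)\<^sup>2) = 1" if "n \<in> LambdaP q d" for n
    using gram[of n n] diag[OF that] l0 by (simp add: power2_eq_square Cd)
  have coh: "\<bar>\<Sum>j<nsamples M. B j n * B j k\<bar> \<le> \<mu>"
    if nk: "n \<in> LambdaP q d" "k \<in> LambdaP q d" "k \<noteq> n" for n k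
  proof -
    have "Cdiag M d n * Cdiag M d k = 1 / sqrt (g n n * g k k)"
      by (simp add: Cd real_sqrt_mult)
    also have "\<dots> \<le> 1 / sqrt ((l / 2) * (l / 2))"
      using diag[OF nk(1)] diag[OF nk(2)] l0
      by (intro divide_left_mono real_sqrt_le_mono mult_mono mult_pos_pos) auto
    also have "sqrt ((l / 2) * (l / 2)) = l / 2"
      using l0 by (intro real_sqrt_unique) (simp_all add: power2_eq_square)
    also have "1 / (l / 2) = 2 / l" by simp
    finally have "Cdiag M d n * Cdiag M d k \<le> 2 / l" .
    hence "\<bar>g n k\<bar> * (Cdiag M d n * Cdiag M d k) \<le> (u / 2) * (2 / l)"
      using offdiag[OF nk(1,2)] nk C0[OF nk(1)] C0[OF nk(2)] u0 by (intro mult_mono) auto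
    thus ?thesis using C0[OF nk(1)] C0[OF nk(2)] by (simp add: gram abs_mult \<mu>_def)
  qed
  \<comment> \<open>The factor \<open>sqrt s\<close> offsets the division by \<open>sqrt s\<close>
    in the claim, since the 2-norm is estimated by the 1-norm. \<open>K\<close> depends on
    \<open>s\<close>, \<open>d\<close> and \<open>M\<close> alone.\<close>
  define K where "K = 2 / (1 - 2 * real s * \<kappa>) * sqrt (real s)"
  show ?thesis
  proof (intro exI[of _ K] conjI allI)
    show "K > 0" using \<kappa> assms(3) by (simp add: K_def)
    fix c y :: "(nat \<Rightarrow> nat) \<Rightarrow> complex"
    define x where "x = (\<lambda>n. c n / complex_of_real (Cdiag M d n))"
    let ?I = "LambdaP q d"
    let ?b = "\<lambda>j. \<Sum>n\<in>?I. c n * complex_of_real (AP M d j n)"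
    \<comment> \<open>The normalization cancels, so \<open>x\<close> is feasible and competes with
      the minimizer \<open>y\<close>.\<close>
    have x: "(\<Sum>n\<in>?I. Amat M d j n * x n) = ?b j" for j
      using C0 by (intro sum.cong) (force simp: Amat_def x_def)+
    have "norm2 (\<lambda>n. y n - x n) ?I \<le> K * sigma_s1 s x ?I / sqrt (real s)"
      if feas: "\<forall>j<nsamples M. (\<Sum>n\<in>?I. Amat M d j n * y n) = ?b j"
        and min: "\<forall>z. (\<forall>j<nsamples M. (\<Sum>n\<in>?I. Amat M d j n * z n) = ?b j) \<longrightarrow> norm1 y ?I \<le> norm1 z ?I"
    proof -
      have le: "norm1 y ?I \<le> norm1 x ?I" using min x by blast
      have ker: "(\<Sum>n\<in>?I. of_real (B j n) * (y n - x n)) = 0" if "j < nsamples M" for j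
        using feas x[of j] that by (simp add: B_def Amat_def right_diff_distrib sum_subtractf)
      have "norm2 (\<lambda>n. y n - x n) ?I \<le> norm1 (\<lambda>n. y n - x n) ?I"
        by (rule norm2_le_norm1)
      also have "\<dots> \<le> 2 / (1 - 2 * real s * \<kappa>) * sigma_s1 s x ?I"
      proof (rule l1_recovery[OF finite_LambdaP _ \<kappa> le])
        fix n assume n: "n \<in> ?I"
        show "cmod (y n - x n) \<le> \<kappa> * norm1 (\<lambda>n. y n - x n) ?I"
          unfolding \<kappa>_def 
          by (rule flat_kernel[where A = B and m = "nsamples M", OF finite_LambdaP n unit[OF n] coh[OF n] ker])
             (use \<mu>0 in auto)
      qed
      also have "\<dots> = K * sigma_s1 s x ?I / sqrt (real s)"
        using assms(3) by (simp add: K_def)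
      finally show ?thesis .
    qed
    thus "let \<Lambda> = LambdaP q d;
         A = Amat M d;
         b = (\<lambda>j. \<Sum>n\<in>\<Lambda>. c n * complex_of_real (AP M d j n));
         ctilde = (\<lambda>n. c n / complex_of_real (Cdiag M d n))
     in ((\<forall>j<nsamples M. (\<Sum>n\<in>\<Lambda>. A j n * y n) = b j)
         \<and> (\<forall>z. (\<forall>j<nsamples M. (\<Sum>n\<in>\<Lambda>. A j n * z n) = b j) \<longrightarrow> norm1 y \<Lambda> \<le> norm1 z \<Lambda>))
        \<longrightarrow> norm2 (\<lambda>n. y n - ctilde n) \<Lambda> \<le> K * sigma_s1 s ctilde \<Lambda> / sqrt (real s)"
      unfolding Let_def x_def[symmetric] by blast
  qed
qed

end
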